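(* Let $(X,\mu)$ be a probability space such that $\mathcal H=L^2(X,\mu)$ is a separable complex Hilbert space, and let $T:\mathcal H\to\mathcal H$ be an isometry. Suppose that $\mathcal H=\mathcal M\oplus\mathcal M^\perp$, where $\mathcal M$ is a closed subspace, $\mathcal M$ and $\mathcal M^\perp$ are invariant under $T$, $T|_{\mathcal M}:\mathcal M\to\mathcal M$ is a shift (unilateral or bilateral) and $T|_{\mathcal M^\perp}$ is the identity operator of $\mathcal M^\perp$. Let $\mathcal V$ be a generating wandering subspace for $T|_{\mathcal M}$, and let $\Pi_{\mathcal M^\perp}$ and $\Pi_k$ be the orthogonal projections of $\mathcal H$ onto $\mathcal M^\perp$ and $T^k(\mathcal V)$ respectively, where $k$ ranges over $\mathbb N\cup\{0\}$ if $T|_{\mathcal M}$ is a unilateral shift and over $\mathbb Z$ if it is a bilateral shift. Let $\varepsilon:[0,+\infty)\to(0,+\infty)$ be a positive decreasing function and, for $f\in L^2(X,\mu)$, define the maximal operator \[ Sf(x)=\sup_{N\ge1}N\varepsilon(N)\bigg|\frac1N\sum_{n=0}^{N-1}T^nf(x)-\Pi_{\mathcal M^\perp}f(x)\bigg| . \] Then there exists a positive constant $c$ such that for every $f\in L^2(X,\mu)$ \[ \|Sf\|_{L^2(X,\mu)}\le c\,\bigg(\sum_{n=0}^{+\infty}\varepsilon^2(n)\log^2(n+2)\bigg)^{\frac12}\sum_k\|\Pi_kf\|_{L^2(X,\mu)} \] (the right-hand side may be $+\infty$). Moreover, if \[ \sum_{n=0}^{+\infty}\varepsilon^2(n)\log^2(n+2)<+\infty\quad\text{and}\quad\sum_k\|\Pi_kf\|_{L^2(X,\mu)}<+\infty,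 \] then, for $\mu$-almost every $x$, \[ \lim_{N\to+\infty}N\varepsilon(N)\bigg|\frac1N\sum_{n=0}^{N-1}T^nf(x)-\Pi_{\mathcal M^\perp}f(x)\bigg|=0 . \]
   Context: Isometry means a bounded linear operator $T$ with $\langle Tf,Tg\rangle=\langle f,g\rangle$ for all $f,g$. An isometry $T:\mathcal M\to\mathcal M$ is a unilateral shift if there is a closed subspace $\mathcal V\subseteq\mathcal M$ (a generating wandering subspace) such that $T^m(\mathcal V)\perp T^n(\mathcal V)$ for all $m\ne n$ in $\mathbb N\cup\{0\}$ and $\mathcal M=\bigoplus_{k\in\mathbb N\cup\{0\}}T^k(\mathcal V)$. A unitary operator $T:\mathcal M\to\mathcal M$ is a bilateral shift if there is a closed subspace $\mathcal V\subseteq\mathcal M$ (a generating wandering subspace) such that $T^m(\mathcal V)\perp T^n(\mathcal V)$ for all $m\neq n$ in $\mathbb Z$ and $\mathcal M=\bigoplus_{k\in\mathbb Z}T^k(\mathcal V)$. Pointwise expressions such as $T^nf(x)$ refer to arbitrary fixed representatives of the $L^2$ classes $T^nf$. The convention $0\cdot\infty=0$ is used. *)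

theory Defs
  imports "HOL-Probability.Probability"
begin

text \<open>
  Elements of the complex Hilbert space \<open>L\<^sup>2(X,\<mu>)\<close> are handled through representatives:
  square-integrable measurable functions, where two functions that agree almost everywhere stand for
  the same element. Accordingly subspaces are sets of functions that are saturated under a.e.
  equality, and operators are maps on functions that respect a.e. equality and satisfy
  their algebraic laws a.e.
\<close>

definition L2 :: "'a measure \<Rightarrow> ('a \<Rightarrow> complex) set" where
  "L2 M = {f \<in> borel_measurable M. integrable M (\<lambda>x. (cmod (f x))\<^sup>2)}"

definition L2_eq :: "'a measure \<Rightarrow> ('a \<Rightarrow> complex) \<Rightarrow> ('a \<Rightarrow> complex) \<Rightarrow> bool" where
  "L2_eq M f g \<longleftrightarrow> (AE x in M. f x = g x)"

definition L2_inner :: "'a measure \<Rightarrow> ('a \<Rightarrow> complex) \<Rightarrow> ('a \<Rightarrow> complex) \<Rightarrow> complex" where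
  "L2_inner M f g = (\<integral>x. f x * cnj (g x) \<partial>M)"

definition L2_norm :: "'a measure \<Rightarrow> ('a \<Rightarrow> complex) \<Rightarrow> real" where
  "L2_norm M f = sqrt (\<integral>x. (cmod (f x))\<^sup>2 \<partial>M)"

definition L2_separable :: "'a measure \<Rightarrow> bool" where
  "L2_separable M \<longleftrightarrow>
     (\<exists>D. countable D \<and> D \<subseteq> L2 M \<and>
        (\<forall>f\<in>L2 M. \<forall>e>0. \<exists>d\<in>D. L2_norm M (\<lambda>x. f x - d x) < e))"

definition L2_closed_subspace :: "'a measure \<Rightarrow> ('a \<Rightarrow> complex) set \<Rightarrow> bool" where
  "L2_closed_subspace M W \<longleftrightarrow>
     W \<subseteq> L2 M \<and>
     (\<forall>f\<in>W. \<forall>g\<in>L2 M. L2_eq M f g \<longrightarrow> g \<in> W) \<and>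
     (\<lambda>x. 0) \<in> W \<and>
     (\<forall>f\<in>W. \<forall>g\<in>W. (\<lambda>x. f x + g x) \<in> W) \<and>
     (\<forall>a. \<forall>f\<in>W. (\<lambda>x. a * f x) \<in> W) \<and>
     (\<forall>s. \<forall>f\<in>L2 M. (\<forall>n::nat. s n \<in> W) \<and>
        (\<lambda>n. L2_norm M (\<lambda>x. s n x - f x)) \<longlonglongrightarrow> 0 \<longrightarrow> f \<in> W)"

definition L2_ortho :: "'a measure \<Rightarrow> ('a \<Rightarrow> complex) set \<Rightarrow> ('a \<Rightarrow> complex) set \<Rightarrow> bool" where
  "L2_ortho M U W \<longleftrightarrow> (\<forall>f\<in>U. \<forall>g\<in>W. L2_inner M f g = 0)"

definition L2_perp :: "'a measure \<Rightarrow> ('a \<Rightarrow> complex) set \<Rightarrow> ('a \<Rightarrow> complex) set" where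
  "L2_perp M W = {f \<in> L2 M. \<forall>g\<in>W. L2_inner M f g = 0}"

text \<open>
  The Hilbert-space direct sum of a pairwise orthogonal family: all unconditionally norm-convergent
  sums with one term from each member of the family.
\<close>

definition L2_direct_sum ::
  "'a measure \<Rightarrow> 'i set \<Rightarrow> ('i \<Rightarrow> ('a \<Rightarrow> complex) set) \<Rightarrow> ('a \<Rightarrow> complex) set" where
  "L2_direct_sum M K H =
     {f \<in> L2 M. \<exists>g. (\<forall>k\<in>K. g k \<in> H k) \<and>
        ((\<lambda>F. L2_norm M (\<lambda>x. f x - (\<Sum>k\<in>F. g k x))) \<longlongrightarrow> 0) (finite_subsets_at_top K)}"

text \<open>The orthogonal projection; the choice is unique up to a.e. equality.\<close>

definition L2_proj ::
  "'a measure \<Rightarrow> ('a \<Rightarrow> complex) set \<Rightarrow> ('a \<Rightarrow> complex) \<Rightarrow> 'a \<Rightarrow> complex" where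
  "L2_proj M W f = (SOME g. g \<in> W \<and> (\<forall>h\<in>W. L2_inner M (\<lambda>x. f x - g x) h = 0))"

text \<open>
  The predicates below speak about the restriction of \<open>T\<close> to the subspace \<open>W\<close>,
  as an operator from \<open>W\<close> to \<open>W\<close>; in particular they include invariance of \<open>W\<close>.
\<close>

definition L2_bounded_operator ::
  "'a measure \<Rightarrow> ('a \<Rightarrow> complex) set \<Rightarrow> (('a \<Rightarrow> complex) \<Rightarrow> 'a \<Rightarrow> complex) \<Rightarrow> bool" where
  "L2_bounded_operator M W T \<longleftrightarrow>
     (\<forall>f\<in>W. T f \<in> W) \<and>
     (\<forall>f\<in>W. \<forall>g\<in>W. L2_eq M f g \<longrightarrow> L2_eq M (T f) (T g)) \<and>
     (\<forall>f\<in>W. \<forall>g\<in>W. L2_eq M (T (\<lambda>x. f x + g x)) (\<lambda>x. T f x + T g x)) \<and>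
     (\<forall>a. \<forall>f\<in>W. L2_eq M (T (\<lambda>x. a * f x)) (\<lambda>x. a * T f x)) \<and>
     (\<exists>B. \<forall>f\<in>W. L2_norm M (T f) \<le> B * L2_norm M f)"

definition L2_isometry ::
  "'a measure \<Rightarrow> ('a \<Rightarrow> complex) set \<Rightarrow> (('a \<Rightarrow> complex) \<Rightarrow> 'a \<Rightarrow> complex) \<Rightarrow> bool" where
  "L2_isometry M W T \<longleftrightarrow>
     L2_bounded_operator M W T \<and>
     (\<forall>f\<in>W. \<forall>g\<in>W. L2_inner M (T f) (T g) = L2_inner M f g)"

definition L2_unitary ::
  "'a measure \<Rightarrow> ('a \<Rightarrow> complex) set \<Rightarrow> (('a \<Rightarrow> complex) \<Rightarrow> 'a \<Rightarrow> complex) \<Rightarrow> bool" where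
  "L2_unitary M W T \<longleftrightarrow> L2_isometry M W T \<and> (\<forall>g\<in>W. \<exists>f\<in>W. L2_eq M (T f) g)"

text \<open>Integer powers of \<open>T\<close> on \<open>W\<close>; negative ones are meaningful when \<open>T\<close> is unitary on \<open>W\<close>.\<close>

definition L2_inverse ::
  "'a measure \<Rightarrow> ('a \<Rightarrow> complex) set \<Rightarrow> (('a \<Rightarrow> complex) \<Rightarrow> 'a \<Rightarrow> complex) \<Rightarrow>
    ('a \<Rightarrow> complex) \<Rightarrow> 'a \<Rightarrow> complex" where
  "L2_inverse M W T g = (SOME f. f \<in> W \<and> L2_eq M (T f) g)"

definition L2_power ::
  "'a measure \<Rightarrow> ('a \<Rightarrow> complex) set \<Rightarrow> (('a \<Rightarrow> complex) \<Rightarrow> 'a \<Rightarrow> complex) \<Rightarrow> int \<Rightarrow>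
    ('a \<Rightarrow> complex) \<Rightarrow> 'a \<Rightarrow> complex" where
  "L2_power M W T k =
     (if 0 \<le> k then T ^^ nat k else L2_inverse M W T ^^ nat (- k))"

text \<open>The image of a set of functions under an operator, saturated under a.e. equality.\<close>

definition L2_image ::
  "'a measure \<Rightarrow> (('a \<Rightarrow> complex) \<Rightarrow> 'a \<Rightarrow> complex) \<Rightarrow> ('a \<Rightarrow> complex) set \<Rightarrow>
    ('a \<Rightarrow> complex) set" where
  "L2_image M P V = {g \<in> L2 M. \<exists>v\<in>V. L2_eq M (P v) g}"

text \<open>
  The index set \<open>K\<close> is \<open>{0..}\<close> in the unilateral case and all of \<open>\<int>\<close> in the bilateral case.
\<close>

definition generating_wandering ::
  "'a measure \<Rightarrow> ('a \<Rightarrow> complex) set \<Rightarrow> (('a \<Rightarrow> complex) \<Rightarrow> 'a \<Rightarrow> complex) \<Rightarrow> int set \<Rightarrow>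
    ('a \<Rightarrow> complex) set \<Rightarrow> bool" where
  "generating_wandering M W T K V \<longleftrightarrow>
     L2_closed_subspace M V \<and> V \<subseteq> W \<and>
     (\<forall>m\<in>K. \<forall>n\<in>K. m \<noteq> n \<longrightarrow>
        L2_ortho M (L2_image M (L2_power M W T m) V) (L2_image M (L2_power M W T n) V)) \<and>
     W = L2_direct_sum M K (\<lambda>k. L2_image M (L2_power M W T k) V)"

definition unilateral_shift ::
  "'a measure \<Rightarrow> ('a \<Rightarrow> complex) set \<Rightarrow> (('a \<Rightarrow> complex) \<Rightarrow> 'a \<Rightarrow> complex) \<Rightarrow> bool" where
  "unilateral_shift M W T \<longleftrightarrow>
     L2_isometry M W T \<and> (\<exists>V. generating_wandering M W T {0..} V)"

definition bilateral_shift ::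
  "'a measure \<Rightarrow> ('a \<Rightarrow> complex) set \<Rightarrow> (('a \<Rightarrow> complex) \<Rightarrow> 'a \<Rightarrow> complex) \<Rightarrow> bool" where
  "bilateral_shift M W T \<longleftrightarrow>
     L2_unitary M W T \<and> (\<exists>V. generating_wandering M W T UNIV V)"

text \<open>
  \<open>F n\<close> and \<open>P\<close> are arbitrary pointwise representatives of \<open>T\<^sup>n f\<close> and of the projection of \<open>f\<close>
  onto the orthogonal complement of \<open>W\<close>.
\<close>

definition representatives ::
  "'a measure \<Rightarrow> ('a \<Rightarrow> complex) set \<Rightarrow> (('a \<Rightarrow> complex) \<Rightarrow> 'a \<Rightarrow> complex) \<Rightarrow>
    ('a \<Rightarrow> complex) \<Rightarrow> (nat \<Rightarrow> 'a \<Rightarrow> complex) \<Rightarrow> ('a \<Rightarrow> complex) \<Rightarrow> bool" where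
  "representatives M W T f F P \<longleftrightarrow>
     (\<forall>n. F n \<in> L2 M \<and> L2_eq M (F n) ((T ^^ n) f)) \<and>
     P \<in> L2 M \<and> L2_eq M P (L2_proj M (L2_perp M W) f)"

definition weighted_deviation ::
  "(real \<Rightarrow> real) \<Rightarrow> (nat \<Rightarrow> 'a \<Rightarrow> complex) \<Rightarrow> ('a \<Rightarrow> complex) \<Rightarrow> nat \<Rightarrow> 'a \<Rightarrow> real" where
  "weighted_deviation \<epsilon> F P N x =
     real N * \<epsilon> (real N) * cmod (1 / of_nat N * (\<Sum>n<N. F n x) - P x)"

definition maximal_operator ::
  "(real \<Rightarrow> real) \<Rightarrow> (nat \<Rightarrow> 'a \<Rightarrow> complex) \<Rightarrow> ('a \<Rightarrow> complex) \<Rightarrow> 'a \<Rightarrow> ennreal" where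
  "maximal_operator \<epsilon> F P x = (SUP N\<in>{1..}. ennreal (weighted_deviation \<epsilon> F P N x))"

definition ennreal_sqrt :: "ennreal \<Rightarrow> ennreal" where
  "ennreal_sqrt t = (if t = \<top> then \<top> else ennreal (sqrt (enn2real t)))"

text \<open>The \<open>L\<^sup>2\<close> norm of a function with values in \<open>[0,\<infinity>]\<close>.\<close>

definition L2_ennnorm :: "'a measure \<Rightarrow> ('a \<Rightarrow> ennreal) \<Rightarrow> ennreal" where
  "L2_ennnorm M S = ennreal_sqrt (\<integral>\<^sup>+x. (S x)\<^sup>2 \<partial>M)"

definition log_square_sum :: "(real \<Rightarrow> real) \<Rightarrow> ennreal" where
  "log_square_sum \<epsilon> = (\<Sum>n. ennreal ((\<epsilon> (real n))\<^sup>2 * (ln (real n + 2))\<^sup>2))"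

definition shift_norm_sum ::
  "'a measure \<Rightarrow> ('a \<Rightarrow> complex) set \<Rightarrow> (('a \<Rightarrow> complex) \<Rightarrow> 'a \<Rightarrow> complex) \<Rightarrow> int set \<Rightarrow>
    ('a \<Rightarrow> complex) set \<Rightarrow> ('a \<Rightarrow> complex) \<Rightarrow> ennreal" where
  "shift_norm_sum M W T K V f =
     (\<Sum>\<^sub>\<infinity>k\<in>K. ennreal (L2_norm M (L2_proj M (L2_image M (L2_power M W T k) V) f)))"

end

theory Submission
  imports Defs
begin

text \<open>
  Write \<open>f = g + h\<close> with \<open>g \<in> W\<close>, \<open>h \<in> W\<^sup>\<bottom>\<close>; then the deviation of the \<open>N\<close>-th ergodic mean, multiplied by
  \<open>N\<close>, is \<open>\<bar>\<Sum>n<N. T\<^sup>n g\<bar>\<close>. The component \<open>g\<^sub>k\<close> of \<open>g\<close> in \<open>T\<^sup>k V\<close> has an orthogonal orbit, so every block of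
  \<open>l\<close> consecutive iterates of \<open>g\<^sub>k\<close> sums to a function of norm \<open>\<surd>l \<parallel>g\<^sub>k\<parallel>\<close>, and every block of iterates of
  \<open>g\<close> to one of norm at most \<open>\<surd>l B\<close>, where \<open>B = \<Sum>\<^sub>k \<parallel>g\<^sub>k\<parallel>\<close>. This block bound replaces orthogonality in
  the Rademacher--Menshov argument, which is therefore applied to the iterates of \<open>g\<close> at once and
  not to each \<open>g\<^sub>k\<close>: decomposing \<open>{..<N}\<close> into dyadic intervals gives a majorant of
  \<open>max \<bar>\<Sum>n<N. T\<^sup>n g\<bar>\<^sup>2\<close> over \<open>2\<^sup>m \<le> N < 2\<^bsup>m+1\<^esup>\<close> with integral at most
  \<open>(m + 2)\<^sup>2 2\<^bsup>m+1\<^esup> B\<^sup>2\<close>. Multiplied by \<open>\<epsilon>(2\<^sup>m)\<^sup>2\<close> and summed over \<open>m\<close>, these majorants dominate \<open>(S f)\<^sup>2\<close>, and since \<open>\<epsilon>\<close> decreases, their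
  total integral is at most a constant times \<open>B\<^sup>2 \<Sum>n. \<epsilon>(n)\<^sup>2 log\<^sup>2(n + 2)\<close>. If this is finite, the sum of
  the majorants is finite almost everywhere, so its terms tend to \<open>0\<close>, which gives the limit.
\<close>

subsection \<open>Square-integrable functions\<close>

lemma L2_measurable: "f \<in> L2 M \<Longrightarrow> f \<in> borel_measurable M"
  by (simp add: L2_def)

lemma L2_integrable_square: "f \<in> L2 M \<Longrightarrow> integrable M (\<lambda>x. (cmod (f x))\<^sup>2)"
  by (simp add: L2_def)

lemma L2_integrable_cmod_mult:
  assumes "f \<in> L2 M" "g \<in> L2 M"
  shows "integrable M (\<lambda>x. cmod (f x) * cmod (g x))"
proof (rule Bochner_Integration.integrable_bound)
  show "integrable M (\<lambda>x. (cmod (f x))\<^sup>2 + (cmod (g x))\<^sup>2)"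
    using assms by (intro Bochner_Integration.integrable_add L2_integrable_square)
  show "(\<lambda>x. cmod (f x) * cmod (g x)) \<in> borel_measurable M"
    using assms[THEN L2_measurable] by measurable
  have "cmod (f x) * cmod (g x) \<le> (cmod (f x))\<^sup>2 + (cmod (g x))\<^sup>2" for x
    using sum_squares_bound[of "cmod (f x)" "cmod (g x)"]
      mult_nonneg_nonneg[of "cmod (f x)" "cmod (g x)"] norm_ge_zero[of "f x"] norm_ge_zero[of "g x"]
    unfolding mult.assoc by linarith
  then show "AE x in M. norm (cmod (f x) * cmod (g x)) \<le> norm ((cmod (f x))\<^sup>2 + (cmod (g x))\<^sup>2)"
    by simp
qed

lemma L2_integrable_mult_cnj:
  assumes "f \<in> L2 M" "g \<in> L2 M"
  shows "integrable M (\<lambda>x. f x * cnj (g x))"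
proof (rule Bochner_Integration.integrable_bound[OF L2_integrable_cmod_mult[OF assms]])
  have "cnj \<in> borel_measurable borel"
    by (intro borel_measurable_continuous_onI continuous_intros)
  then show "(\<lambda>x. f x * cnj (g x)) \<in> borel_measurable M"
    using assms[THEN L2_measurable] by measurable
qed (simp add: norm_mult)

lemma L2_zero: "(\<lambda>x. 0) \<in> L2 M"
  by (simp add: L2_def)

lemma L2_add:
  assumes "f \<in> L2 M" "g \<in> L2 M"
  shows "(\<lambda>x. f x + g x) \<in> L2 M"
proof -
  have meas: "(\<lambda>x. f x + g x) \<in> borel_measurable M"
    using assms[THEN L2_measurable] by measurable
  have "integrable M (\<lambda>x. (cmod (f x + g x))\<^sup>2)"
  proof (rule Bochner_Integration.integrable_bound)
    show "integrable M (\<lambda>x. (cmod (f x))\<^sup>2 + 2 * (cmod (f x) * cmod (g x)) + (cmod (g x))\<^sup>2)"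
      using assms by (intro Bochner_Integration.integrable_add L2_integrable_square
          integrable_mult_right L2_integrable_cmod_mult)
    show "(\<lambda>x. (cmod (f x + g x))\<^sup>2) \<in> borel_measurable M"
      using meas by measurable
    have "(cmod (f x + g x))\<^sup>2 \<le> (cmod (f x) + cmod (g x))\<^sup>2" for x
      by (intro power_mono norm_triangle_ineq norm_ge_zero)
    then show "AE x in M. norm ((cmod (f x + g x))\<^sup>2)
        \<le> norm ((cmod (f x))\<^sup>2 + 2 * (cmod (f x) * cmod (g x)) + (cmod (g x))\<^sup>2)"
      by (simp add: power2_sum algebra_simps)
  qed
  with meas show ?thesis by (simp add: L2_def)
qed

lemma L2_cmult:
  assumes "f \<in> L2 M"
  shows "(\<lambda>x. a * f x) \<in> L2 M"
  using assms by (auto simp: L2_def norm_mult power_mult_distrib)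

lemma L2_diff:
  assumes "f \<in> L2 M" "g \<in> L2 M"
  shows "(\<lambda>x. f x - g x) \<in> L2 M"
  using L2_add[OF assms(1) L2_cmult[OF assms(2), of "- 1"]] by simp

lemma L2_sum:
  assumes "\<And>i. i \<in> I \<Longrightarrow> f i \<in> L2 M"
  shows "(\<lambda>x. \<Sum>i\<in>I. f i x) \<in> L2 M"
  using assms by (induction I rule: infinite_finite_induct) (auto intro: L2_zero L2_add)

lemma L2_eq_refl: "L2_eq M f f"
  by (simp add: L2_eq_def)

lemma L2_eq_sym: "L2_eq M f g \<Longrightarrow> L2_eq M g f"
  by (auto simp: L2_eq_def)

lemma L2_eq_trans: "L2_eq M f g \<Longrightarrow> L2_eq M g h \<Longrightarrow> L2_eq M f h"
  by (auto simp: L2_eq_def)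

lemma L2_eq_add: "L2_eq M f f' \<Longrightarrow> L2_eq M g g' \<Longrightarrow> L2_eq M (\<lambda>x. f x + g x) (\<lambda>x. f' x + g' x)"
  by (auto simp: L2_eq_def)

lemma L2_eq_sum:
  assumes "\<And>i. i \<in> I \<Longrightarrow> L2_eq M (f i) (g i)"
  shows "L2_eq M (\<lambda>x. \<Sum>i\<in>I. f i x) (\<lambda>x. \<Sum>i\<in>I. g i x)"
  using assms
  by (induction I rule: infinite_finite_induct) (auto intro: L2_eq_refl L2_eq_add)

section \<open>Inner product and norm of representatives\<close>

lemma L2_inner_cong:
  assumes "f \<in> L2 M" "f' \<in> L2 M" "g \<in> L2 M" "g' \<in> L2 M" "L2_eq M f f'" "L2_eq M g g'"
  shows "L2_inner M f g = L2_inner M f' g'"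
  unfolding L2_inner_def
proof (rule integral_cong_AE)
  show "AE x in M. f x * cnj (g x) = f' x * cnj (g' x)"
    using assms(5,6) unfolding L2_eq_def by eventually_elim simp
qed (use assms in \<open>auto intro: borel_measurable_integrable L2_integrable_mult_cnj\<close>)

lemma L2_norm_cong:
  assumes "f \<in> L2 M" "g \<in> L2 M" "L2_eq M f g"
  shows "L2_norm M f = L2_norm M g"
proof -
  have "(\<integral>x. (cmod (f x))\<^sup>2 \<partial>M) = (\<integral>x. (cmod (g x))\<^sup>2 \<partial>M)"
  proof (rule integral_cong_AE)
    show "AE x in M. (cmod (f x))\<^sup>2 = (cmod (g x))\<^sup>2"
      using assms(3) unfolding L2_eq_def by eventually_elim simp
  qed (use assms in \<open>auto intro: borel_measurable_integrable L2_integrable_square\<close>)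
  then show ?thesis by (simp add: L2_norm_def)
qed

lemma L2_norm_nonneg: "0 \<le> L2_norm M f"
  by (simp add: L2_norm_def)

lemma L2_norm_square: "(L2_norm M f)\<^sup>2 = (\<integral>x. (cmod (f x))\<^sup>2 \<partial>M)"
  by (simp add: L2_norm_def)

lemma L2_inner_self: "L2_inner M f f = of_real ((L2_norm M f)\<^sup>2)"
proof -
  have "L2_inner M f f = (\<integral>x. of_real ((cmod (f x))\<^sup>2) \<partial>M)"
    unfolding L2_inner_def
    by (intro arg_cong[of _ _ "integral\<^sup>L M"]) (simp add: fun_eq_iff complex_norm_square flip: of_real_power)
  also have "\<dots> = of_real (\<integral>x. (cmod (f x))\<^sup>2 \<partial>M)" by (rule integral_complex_of_real)
  finally show ?thesis by (simp add: L2_norm_square)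
qed

lemma L2_norm_eq_0_iff:
  assumes "f \<in> L2 M"
  shows "L2_norm M f = 0 \<longleftrightarrow> (AE x in M. f x = 0)"
  using integral_nonneg_eq_0_iff_AE[OF L2_integrable_square[OF assms]]
  by (simp add: L2_norm_def)

lemma L2_inner_add_left:
  assumes "f \<in> L2 M" "g \<in> L2 M" "h \<in> L2 M"
  shows "L2_inner M (\<lambda>x. f x + g x) h = L2_inner M f h + L2_inner M g h"
  unfolding L2_inner_def
  using Bochner_Integration.integral_add[OF L2_integrable_mult_cnj[OF assms(1,3)]
      L2_integrable_mult_cnj[OF assms(2,3)]]
  by (simp add: distrib_right)

lemma L2_inner_diff_left:
  assumes "f \<in> L2 M" "g \<in> L2 M" "h \<in> L2 M"
  shows "L2_inner M (\<lambda>x. f x - g x) h = L2_inner M f h - L2_inner M g h"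
  unfolding L2_inner_def
  using Bochner_Integration.integral_diff[OF L2_integrable_mult_cnj[OF assms(1,3)]
      L2_integrable_mult_cnj[OF assms(2,3)]]
  by (simp add: left_diff_distrib)

lemma L2_inner_commute: "L2_inner M g f = cnj (L2_inner M f g)"
proof -
  have "cnj (L2_inner M f g) = (\<integral>x. cnj (f x * cnj (g x)) \<partial>M)"
    unfolding L2_inner_def by (simp only: Bochner_Integration.integral_cnj)
  then show ?thesis by (simp add: L2_inner_def mult.commute)
qed

lemma L2_inner_diff_right:
  assumes "f \<in> L2 M" "g \<in> L2 M" "h \<in> L2 M"
  shows "L2_inner M h (\<lambda>x. f x - g x) = L2_inner M h f - L2_inner M h g"
  using L2_inner_diff_left[OF assms] by (metis L2_inner_commute complex_cnj_diff)

lemma L2_inner_sum_left: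
  assumes "\<And>i. i \<in> I \<Longrightarrow> f i \<in> L2 M" "h \<in> L2 M"
  shows "L2_inner M (\<lambda>x. \<Sum>i\<in>I. f i x) h = (\<Sum>i\<in>I. L2_inner M (f i) h)"
  unfolding L2_inner_def sum_distrib_right
  by (rule Bochner_Integration.integral_sum) (use assms in \<open>auto intro: L2_integrable_mult_cnj\<close>)

lemma L2_inner_sum_right:
  assumes "\<And>i. i \<in> I \<Longrightarrow> f i \<in> L2 M" "h \<in> L2 M"
  shows "L2_inner M h (\<lambda>x. \<Sum>i\<in>I. f i x) = (\<Sum>i\<in>I. L2_inner M h (f i))"
proof -
  have "L2_inner M h (\<lambda>x. \<Sum>i\<in>I. f i x) = cnj (\<Sum>i\<in>I. L2_inner M (f i) h)"
    by (subst L2_inner_commute) (simp only: L2_inner_sum_left[OF assms])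
  then show ?thesis
    by (simp add: L2_inner_commute[of M h])
qed

text \<open>The absolute values stay inside the integral because the triangle inequality for
  \<open>L2_norm\<close> has to bound the cross term \<open>2 |f| |g|\<close> of a pointwise
  square.\<close>

lemma L2_Cauchy_Schwarz_cmod:
  assumes "f \<in> L2 M" "g \<in> L2 M"
  shows "(\<integral>x. cmod (f x) * cmod (g x) \<partial>M) \<le> L2_norm M f * L2_norm M g"
proof -
  let ?I = "\<integral>x. cmod (f x) * cmod (g x) \<partial>M"
  let ?a = "L2_norm M f" and ?b = "L2_norm M g"
  note nn = L2_norm_nonneg[of M f] L2_norm_nonneg[of M g]
  \<comment> \<open>This integrates \<open>0 \<le> (s |f| - t |g|)\<^sup>2\<close>. For
    \<open>s = ?b\<close> and \<open>t = ?a\<close> it is the claim multiplied by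
    \<open>2 * ?a * ?b\<close>, so a zero norm has to be treated apart.\<close>
  have scaled: "2 * s * t * ?I \<le> s\<^sup>2 * ?a\<^sup>2 + t\<^sup>2 * ?b\<^sup>2" for s t :: real
  proof -
    have "2 * s * t * ?I = (\<integral>x. 2 * s * t * (cmod (f x) * cmod (g x)) \<partial>M)"
      using L2_integrable_cmod_mult[OF assms] by simp
    also have "\<dots> \<le> (\<integral>x. s\<^sup>2 * (cmod (f x))\<^sup>2 + t\<^sup>2 * (cmod (g x))\<^sup>2 \<partial>M)"
    proof (rule integral_mono)
      show "2 * s * t * (cmod (f x) * cmod (g x)) \<le> s\<^sup>2 * (cmod (f x))\<^sup>2 + t\<^sup>2 * (cmod (g x))\<^sup>2"
        for x using sum_squares_bound[of "s * cmod (f x)" "t * cmod (g x)"]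
        by (simp add: power_mult_distrib mult_ac)
    qed (use assms in \<open>auto intro!: Bochner_Integration.integrable_add integrable_mult_right
          L2_integrable_square L2_integrable_cmod_mult\<close>)
    also have "\<dots> = s\<^sup>2 * ?a\<^sup>2 + t\<^sup>2 * ?b\<^sup>2"
      using assms[THEN L2_integrable_square] by (simp add: L2_norm_square)
    finally show ?thesis .
  qed
  show ?thesis
  proof (cases "?a = 0 \<or> ?b = 0")
    case True
    then have "AE x in M. cmod (f x) * cmod (g x) = 0"
      using assms by (auto simp: L2_norm_eq_0_iff)
    then have "?I = 0" by (rule integral_eq_zero_AE)
    then show ?thesis using nn by simp
  next
    case False
    then have "0 < ?a * ?b" using nn by simp
    moreover have "(?a * ?b) * ?I \<le> (?a * ?b) * (?a * ?b)"
      using scaled[of ?b ?a] by (simp add: power2_eq_square algebra_simps)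
    ultimately show ?thesis by (meson mult_le_cancel_left_pos)
  qed
qed

lemma L2_Cauchy_Schwarz:
  assumes "f \<in> L2 M" "g \<in> L2 M"
  shows "cmod (L2_inner M f g) \<le> L2_norm M f * L2_norm M g"
proof -
  have "cmod (L2_inner M f g) \<le> (\<integral>x. cmod (f x * cnj (g x)) \<partial>M)"
    unfolding L2_inner_def by (rule integral_norm_bound)
  also have "\<dots> \<le> L2_norm M f * L2_norm M g"
    using L2_Cauchy_Schwarz_cmod[OF assms] by (simp add: norm_mult)
  finally show ?thesis .
qed

lemma L2_norm_triangle:
  assumes "f \<in> L2 M" "g \<in> L2 M"
  shows "L2_norm M (\<lambda>x. f x + g x) \<le> L2_norm M f + L2_norm M g"
proof (rule power2_le_imp_le)
  have "(L2_norm M (\<lambda>x. f x + g x))\<^sup>2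
      \<le> (\<integral>x. (cmod (f x))\<^sup>2 + 2 * (cmod (f x) * cmod (g x)) + (cmod (g x))\<^sup>2 \<partial>M)"
    unfolding L2_norm_square
  proof (rule integral_mono)
    show "(cmod (f x + g x))\<^sup>2 \<le> (cmod (f x))\<^sup>2 + 2 * (cmod (f x) * cmod (g x)) + (cmod (g x))\<^sup>2"
      for x using power_mono[OF norm_triangle_ineq[of "f x" "g x"], of 2]
      by (simp add: power2_sum algebra_simps)
  qed (use assms in \<open>auto intro!: Bochner_Integration.integrable_add integrable_mult_right
        L2_integrable_square L2_integrable_cmod_mult L2_add\<close>)
  also have "\<dots> = (L2_norm M f)\<^sup>2 + 2 * (\<integral>x. cmod (f x) * cmod (g x) \<partial>M) + (L2_norm M g)\<^sup>2"
    using assms[THEN L2_integrable_square] L2_integrable_cmod_mult[OF assms]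
    by (simp add: L2_norm_square)
  also have "\<dots> \<le> (L2_norm M f + L2_norm M g)\<^sup>2"
    using L2_Cauchy_Schwarz_cmod[OF assms] by (simp add: power2_sum)
  finally show "(L2_norm M (\<lambda>x. f x + g x))\<^sup>2 \<le> (L2_norm M f + L2_norm M g)\<^sup>2" .
qed (simp add: L2_norm_nonneg)

lemma L2_norm_sum_le:
  assumes "\<And>i. i \<in> I \<Longrightarrow> f i \<in> L2 M"
  shows "L2_norm M (\<lambda>x. \<Sum>i\<in>I. f i x) \<le> (\<Sum>i\<in>I. L2_norm M (f i))"
  using assms
proof (induction I rule: infinite_finite_induct)
  case (insert i I)
  then show ?case
    using L2_norm_triangle[of "f i" M "\<lambda>x. \<Sum>i\<in>I. f i x"] L2_sum[of I f M] by fastforce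
qed (auto simp: L2_norm_def)

section \<open>Pythagoras and orthogonal projections\<close>

lemma L2_norm_orthogonal_sum:
  assumes "finite I" and f: "\<And>i. i \<in> I \<Longrightarrow> f i \<in> L2 M"
    and orth: "\<And>i j. i \<in> I \<Longrightarrow> j \<in> I \<Longrightarrow> i \<noteq> j \<Longrightarrow> L2_inner M (f i) (f j) = 0"
  shows "(L2_norm M (\<lambda>x. \<Sum>i\<in>I. f i x))\<^sup>2 = (\<Sum>i\<in>I. (L2_norm M (f i))\<^sup>2)"
proof -
  have S: "(\<lambda>x. \<Sum>i\<in>I. f i x) \<in> L2 M" by (rule L2_sum[OF f])
  have "L2_inner M (\<lambda>x. \<Sum>i\<in>I. f i x) (\<lambda>x. \<Sum>i\<in>I. f i x)
      = (\<Sum>i\<in>I. \<Sum>j\<in>I. L2_inner M (f i) (f j))"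
    using f S by (simp add: L2_inner_sum_left L2_inner_sum_right)
  also have "\<dots> = (\<Sum>i\<in>I. \<Sum>j\<in>I. if j = i then L2_inner M (f i) (f i) else 0)"
    by (intro sum.cong refl) (auto simp: orth)
  also have "\<dots> = (\<Sum>i\<in>I. L2_inner M (f i) (f i))"
    using assms(1) by simp
  finally have "complex_of_real ((L2_norm M (\<lambda>x. \<Sum>i\<in>I. f i x))\<^sup>2)
      = of_real (\<Sum>i\<in>I. (L2_norm M (f i))\<^sup>2)"
    by (simp add: L2_inner_self)
  then show ?thesis by (rule of_real_eq_iff[THEN iffD1])
qed

text \<open>The difference of two candidates need not lie in \<open>W\<close>, so it is tested against each of them
  separately; this spares a proof that \<open>T\<^sup>k V\<close> is a subspace.\<close>

lemma L2_proj_unique: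
  assumes "W \<subseteq> L2 M" "f \<in> L2 M" "g \<in> W" and g: "\<And>h. h \<in> W \<Longrightarrow> L2_inner M (\<lambda>x. f x - g x) h = 0"
  shows "L2_proj M W f \<in> W" "L2_eq M (L2_proj M W f) g"
proof -
  define p where "p = L2_proj M W f"
  have "p \<in> W \<and> (\<forall>h\<in>W. L2_inner M (\<lambda>x. f x - p x) h = 0)"
    unfolding p_def L2_proj_def by (rule someI[of _ g]) (use assms in auto)
  then have p: "p \<in> W" "\<And>h. h \<in> W \<Longrightarrow> L2_inner M (\<lambda>x. f x - p x) h = 0"
    by auto
  have L: "p \<in> L2 M" "g \<in> L2 M" using p(1) assms by auto
  have "L2_inner M (\<lambda>x. p x - g x) h = 0" if "h \<in> W" for h
    using g[OF that] p(2)[OF that] that assms L by (auto simp: L2_inner_diff_left subset_eq)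
  then have "L2_inner M (\<lambda>x. p x - g x) (\<lambda>x. p x - g x) = 0"
    using L p(1) assms(3) by (subst L2_inner_diff_right) (auto intro: L2_diff)
  then have "L2_norm M (\<lambda>x. p x - g x) = 0"
    by (simp add: L2_inner_self)
  then show "L2_eq M (L2_proj M W f) g"
    using L by (simp add: L2_norm_eq_0_iff L2_diff L2_eq_def p_def)
  show "L2_proj M W f \<in> W" using p(1) by (simp add: p_def)
qed

subsection \<open>A maximal inequality of Rademacher--Menshov type\<close>

text \<open>The nodes of the tree of dyadic subintervals of \<open>{a..<a + 2 ^ m}\<close>, down to
  single indices, each contribute the squared modulus of their block sum. Each of the m + 1 levels
  of the tree partitions the interval.\<close>

fun dyadic_square_sum :: "(nat \<Rightarrow> complex) \<Rightarrow> nat \<Rightarrow> nat \<Rightarrow> real" where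
  "dyadic_square_sum u 0 a = (cmod (u a))\<^sup>2"
| "dyadic_square_sum u (Suc m) a = dyadic_square_sum u m a + dyadic_square_sum u m (a + 2 ^ m)
     + (cmod (\<Sum>n\<in>{a..<a + 2 ^ Suc m}. u n))\<^sup>2"

lemma dyadic_square_sum_nonneg: "0 \<le> dyadic_square_sum u m a"
  by (induction m arbitrary: a) simp_all

lemma norm_full_block_le_dyadic_square_sum:
  "(cmod (\<Sum>n\<in>{a..<a + 2 ^ m}. u n))\<^sup>2 \<le> dyadic_square_sum u m a"
  by (cases m) (simp_all add: dyadic_square_sum_nonneg)

text \<open>Cauchy--Schwarz with weights 1 and r. Equal weights could double the constant at each
  level of the tree, whereas here it grows only from r to r + 1.\<close>

lemma weighted_square_add_le:
  fixes x y p q r :: real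
  assumes "0 < r" "x\<^sup>2 \<le> p" "y\<^sup>2 \<le> r * q"
  shows "(x + y)\<^sup>2 \<le> (r + 1) * (p + q)"
proof -
  \<comment> \<open>The added square is the exact defect in Cauchy--Schwarz: it cancels the cross
    terms.\<close>
  have "r * (x + y)\<^sup>2 \<le> r * (x + y)\<^sup>2 + (r * x - y)\<^sup>2"
    by simp
  also have "\<dots> = (r + 1) * (r * x\<^sup>2 + y\<^sup>2)"
    by (simp add: power2_eq_square algebra_simps)
  also have "\<dots> \<le> (r + 1) * (r * p + r * q)"
    using assms by (intro mult_left_mono add_mono) auto
  finally have "r * (x + y)\<^sup>2 \<le> r * ((r + 1) * (p + q))"
    by (simp add: algebra_simps)
  with assms(1) show ?thesis by simp
qed

text \<open>A prefix of a dyadic interval either lies in its left half or is the whole left half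
  followed by a prefix of the right half, so it is made of at most one node per level. The bound
  does not depend on N and therefore controls the maximum over all prefixes.\<close>

lemma norm_block_le_dyadic_square_sum:
  assumes "N \<le> 2 ^ m"
  shows "(cmod (\<Sum>n\<in>{a..<a + N}. u n))\<^sup>2 \<le> (real m + 1) * dyadic_square_sum u m a"
  using assms
proof (induction m arbitrary: a N)
  case 0
  then consider "N = 0" | "N = 1" by fastforce
  then show ?case by cases simp_all
next
  case (Suc m)
  note nn = dyadic_square_sum_nonneg
  let ?D = "dyadic_square_sum u m"
  have le: "?D a + ?D (a + 2 ^ m) \<le> dyadic_square_sum u (Suc m) a"
    by simp
  show ?case
  proof (cases "N \<le> 2 ^ m")
    case True
    have "(cmod (\<Sum>n\<in>{a..<a + N}. u n))\<^sup>2 \<le> (real m + 1) * ?D a"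
      by (rule Suc.IH[OF True])
    also have "\<dots> \<le> (real (Suc m) + 1) * dyadic_square_sum u (Suc m) a"
      using le nn[of u m "a + 2 ^ m"] nn[of u m a] by (intro mult_mono) auto
    finally show ?thesis .
  next
    case False
    define N' where "N' = N - 2 ^ m"
    have N: "N = 2 ^ m + N'" "N' \<le> 2 ^ m"
      using False Suc.prems by (auto simp: N'_def)
    have split: "(\<Sum>n\<in>{a..<a + N}. u n)
        = (\<Sum>n\<in>{a..<a + 2 ^ m}. u n) + (\<Sum>n\<in>{a + 2 ^ m..<a + 2 ^ m + N'}. u n)"
      using sum.atLeastLessThan_concat[of a "a + 2 ^ m" "a + N" u] by (simp add: N(1) add.assoc)
    have "(cmod (\<Sum>n\<in>{a..<a + N}. u n))\<^sup>2 \<le> (cmod (\<Sum>n\<in>{a..<a + 2 ^ m}. u n)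
        + cmod (\<Sum>n\<in>{a + 2 ^ m..<a + 2 ^ m + N'}. u n))\<^sup>2"
      unfolding split by (intro power_mono norm_triangle_ineq norm_ge_zero)
    \<comment> \<open>The left half is a node of the tree and costs the factor 1, the prefix of the
      right half costs \<open>real m + 1\<close> by induction; hence the weight
      \<open>r = real m + 1\<close>.\<close>
    also have "\<dots> \<le> ((real m + 1) + 1) * (?D a + ?D (a + 2 ^ m))"
      using norm_full_block_le_dyadic_square_sum[where u = u and m = m and a = a]
        Suc.IH[OF N(2), of "a + 2 ^ m"]
      by (intro weighted_square_add_le) auto
    also have "\<dots> \<le> (real (Suc m) + 1) * dyadic_square_sum u (Suc m) a"
      using le by (intro mult_mono) (auto simp: nn simp del: dyadic_square_sum.simps)
    finally show ?thesis .
  qed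
qed

text \<open>The blocks on one level have total length \<open>2 ^ m\<close>, so by
  \<open>block\<close> each of the m + 1 levels contributes at most
  \<open>2 ^ m * C\<close>.\<close>

lemma dyadic_square_sum_integral:
  assumes L2: "\<And>n. \<phi> n \<in> L2 M"
    and block: "\<And>a l. (L2_norm M (\<lambda>x. \<Sum>n\<in>{a..<a + l}. \<phi> n x))\<^sup>2 \<le> real l * C"
  shows "integrable M (\<lambda>x. dyadic_square_sum (\<lambda>n. \<phi> n x) m a)"
    and "(\<integral>x. dyadic_square_sum (\<lambda>n. \<phi> n x) m a \<partial>M) \<le> (real m + 1) * 2 ^ m * C"
proof (induction m arbitrary: a)
  case 0
  {
    case 1
    show ?case using L2_integrable_square[OF L2] by simp
  next
    case 2
    show ?case using block[of a 1] by (simp add: L2_norm_square)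
  }
next
  case (Suc m)
  have sq: "integrable M (\<lambda>x. (cmod (\<Sum>n\<in>{a..<a + 2 ^ Suc m}. \<phi> n x))\<^sup>2)" for a
    by (intro L2_integrable_square L2_sum L2)
  {
    case 1
    show ?case
      unfolding dyadic_square_sum.simps
      by (intro Bochner_Integration.integrable_add Suc.IH(1) sq)
  next
    case 2
    have "(\<integral>x. dyadic_square_sum (\<lambda>n. \<phi> n x) (Suc m) a \<partial>M)
        = (\<integral>x. dyadic_square_sum (\<lambda>n. \<phi> n x) m a \<partial>M)
          + (\<integral>x. dyadic_square_sum (\<lambda>n. \<phi> n x) m (a + 2 ^ m) \<partial>M)
          + (L2_norm M (\<lambda>x. \<Sum>n\<in>{a..<a + 2 ^ Suc m}. \<phi> n x))\<^sup>2"
      unfolding dyadic_square_sum.simps L2_norm_square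
      using Suc.IH(1) sq by (simp add: Bochner_Integration.integral_add)
    also have "\<dots> \<le> (real m + 1) * 2 ^ m * C + (real m + 1) * 2 ^ m * C + real (2 ^ Suc m) * C"
      by (intro add_mono Suc.IH(2) block)
    also have "\<dots> = (real (Suc m) + 1) * 2 ^ Suc m * C"
      by (simp add: algebra_simps)
    finally show ?case .
  }
qed

section \<open>Comparison of the dyadic weights with the logarithmic series\<close>

lemma ln_2_mult_le_ln:
  assumes "2 ^ p \<le> n"
  shows "(real p + 3) * ln 2 \<le> 3 * ln (real n + 2)"
proof -
  define y where "y = real n"
  have "2 ^ p \<le> y" using assms by (simp add: y_def)
  \<comment> \<open>The cube absorbs the shift by 3, since \<open>2 ^ (p + 3) = 8 * 2 ^ p\<close>.
    This shift is the one in the weight \<open>(real m + 2)\<^sup>2\<close> at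
    \<open>m = Suc p\<close>.\<close>
  moreover have "8 * y \<le> (y + 2) ^ 3"
    by (simp add: y_def power3_eq_cube algebra_simps)
  ultimately have "2 ^ (p + 3) \<le> (y + 2) ^ 3"
    by (simp add: power_add)
  then have "ln (2 ^ (p + 3)) \<le> ln ((y + 2) ^ 3)"
    by (subst ln_le_cancel_iff) (auto simp: y_def)
  then show ?thesis
    by (simp add: ln_realpow y_def)
qed

text \<open>Cauchy condensation: as \<epsilon> decreases, the weight at \<open>m = Suc p\<close> is
  paid for by the terms with index in \<open>{2 ^ p..<2 ^ Suc p}\<close>, just below
  \<open>2 ^ m\<close>. These index blocks are disjoint for different p.\<close>

lemma dyadic_weight_sum_le:
  fixes \<epsilon> :: "real \<Rightarrow> real"
  assumes pos: "\<forall>t\<ge>0. 0 < \<epsilon> t" and anti: "antimono_on {0..} \<epsilon>"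
  shows "(\<Sum>m\<le>p. (\<epsilon> (2 ^ m))\<^sup>2 * ((real m + 2)\<^sup>2 * 2 ^ Suc m))
    \<le> 36 / (ln 2)\<^sup>2 * (\<Sum>n<2 ^ p. (\<epsilon> (real n))\<^sup>2 * (ln (real n + 2))\<^sup>2)"
proof (induction p)
  case 0
  \<comment> \<open>The weight at m = 0 is \<open>8 * (\<epsilon> 1)\<^sup>2\<close>. The term n = 0
    pays for it: its factor \<open>(ln 2)\<^sup>2\<close> cancels and leaves
    \<open>36 * (\<epsilon> 0)\<^sup>2\<close>.\<close>
  have "\<epsilon> 1 \<le> \<epsilon> 0" using anti by (simp add: monotone_on_def)
  then have "(\<epsilon> 1)\<^sup>2 \<le> (\<epsilon> 0)\<^sup>2" using pos by (intro power_mono) (auto simp: less_imp_le)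
  then have "2 * (\<epsilon> 1)\<^sup>2 \<le> 9 * (\<epsilon> 0)\<^sup>2" by (smt (verit) zero_le_power2)
  then show ?case by simp
next
  case (Suc p)
  let ?a = "\<lambda>n. (\<epsilon> (real n))\<^sup>2 * (ln (real n + 2))\<^sup>2"
  let ?e = "\<epsilon> (2 ^ Suc p)"
  have lower: "?e\<^sup>2 * ((real p + 3) * ln 2 / 3)\<^sup>2 \<le> ?a n" if "n \<in> {2 ^ p..<2 ^ Suc p}" for n
  proof -
    have "n \<le> 2 ^ Suc p" using that by simp
    then have "real n \<le> 2 ^ Suc p" by (simp only: of_nat_le_numeral_power_cancel_iff)
    then have "?e \<le> \<epsilon> (real n)" using anti by (auto simp: monotone_on_def)
    moreover have "(real p + 3) * ln 2 / 3 \<le> ln (real n + 2)"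
      using ln_2_mult_le_ln[of p n] that by simp
    ultimately show ?thesis
      using pos by (intro mult_mono power_mono) (auto simp: less_imp_le)
  qed
  \<comment> \<open>The block has \<open>2 ^ p\<close> terms against the factor
    \<open>4 * 2 ^ p\<close> in the weight, and the lower bound carries
    \<open>(1 / 3)\<^sup>2\<close>; hence 36 = 4 * 9.\<close>
  have "?e\<^sup>2 * ((real (Suc p) + 2)\<^sup>2 * 2 ^ Suc (Suc p))
      = 36 / (ln 2)\<^sup>2 * (\<Sum>n\<in>{2 ^ p..<2 ^ Suc p::nat}. ?e\<^sup>2 * ((real p + 3) * ln 2 / 3)\<^sup>2)"
  proof -
    have "e * (q\<^sup>2 * (4 * z)) = 36 * (z * (e * (q * L / 3)\<^sup>2)) / L\<^sup>2"
      if "L \<noteq> 0" for e q z L :: real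
      using that by (simp add: power2_eq_square)
    from this[of "ln 2" "?e\<^sup>2" "real p + 3" "2 ^ p"] show ?thesis
      by (simp add: add.commute[of 3])
  qed
  also have "\<dots> \<le> 36 / (ln 2)\<^sup>2 * (\<Sum>n\<in>{2 ^ p..<2 ^ Suc p}. ?a n)"
    by (intro mult_left_mono sum_mono lower) auto
  finally have step: "?e\<^sup>2 * ((real (Suc p) + 2)\<^sup>2 * 2 ^ Suc (Suc p))
      \<le> 36 / (ln 2)\<^sup>2 * (\<Sum>n\<in>{2 ^ p..<2 ^ Suc p}. ?a n)" .
  have "(\<Sum>n<2 ^ Suc p. ?a n) = (\<Sum>n<2 ^ p. ?a n) + (\<Sum>n\<in>{2 ^ p..<2 ^ Suc p}. ?a n)"
    using sum.atLeastLessThan_concat[of 0 "2 ^ p" "2 ^ Suc p" ?a] by (simp add: lessThan_atLeast0)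
  with add_mono[OF Suc.IH step] show ?case
    by (simp only: sum.atMost_Suc distrib_left)
qed

text \<open>For \<open>2 ^ m \<le> N < 2 ^ Suc m\<close> the sum up to N runs over a prefix of
  \<open>{0..<2 ^ Suc m}\<close>, whence \<open>Suc m\<close> and the factor m + 2. The function
  \<epsilon> is taken at the left end of the block, where it is largest.\<close>

definition dyadic_majorant :: "(real \<Rightarrow> real) \<Rightarrow> (nat \<Rightarrow> complex) \<Rightarrow> nat \<Rightarrow> real" where
  "dyadic_majorant \<epsilon> u m = (\<epsilon> (2 ^ m))\<^sup>2 * ((real m + 2) * dyadic_square_sum u (Suc m) 0)"

lemma dyadic_majorant_nonneg: "0 \<le> dyadic_majorant \<epsilon> u m"
  by (simp add: dyadic_majorant_def dyadic_square_sum_nonneg del: dyadic_square_sum.simps)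

lemma weighted_partial_sum_le_dyadic_majorant:
  assumes pos: "\<forall>t\<ge>0. 0 < \<epsilon> t" and anti: "antimono_on {0..} \<epsilon>"
    and N: "2 ^ m \<le> N" "N < 2 ^ Suc m"
  shows "(\<epsilon> (real N) * cmod (\<Sum>n<N. u n))\<^sup>2 \<le> dyadic_majorant \<epsilon> u m"
proof -
  have "2 ^ m \<le> real N" using N(1) by simp
  then have "\<epsilon> (real N) \<le> \<epsilon> (2 ^ m)" using anti by (auto simp: monotone_on_def)
  then have "(\<epsilon> (real N))\<^sup>2 \<le> (\<epsilon> (2 ^ m))\<^sup>2"
    using pos by (intro power_mono) (auto simp: less_imp_le)
  moreover have "(cmod (\<Sum>n<N. u n))\<^sup>2 \<le> (real m + 2) * dyadic_square_sum u (Suc m) 0"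
    using norm_block_le_dyadic_square_sum[of N "Suc m" u 0] N(2)
    by (simp add: lessThan_atLeast0 add.commute del: dyadic_square_sum.simps)
  ultimately show ?thesis
    unfolding dyadic_majorant_def power_mult_distrib by (intro mult_mono) auto
qed

lemma nat_in_dyadic_block:
  fixes N :: nat
  assumes "1 \<le> N"
  obtains m where "2 ^ m \<le> N" "N < 2 ^ Suc m"
  using ex_power_ivl1[of 2 N] assms by auto

lemma weighted_partial_sum_le_suminf:
  assumes "\<forall>t\<ge>0. 0 < \<epsilon> t" "antimono_on {0..} \<epsilon>" "1 \<le> N"
  shows "ennreal ((\<epsilon> (real N) * cmod (\<Sum>n<N. u n))\<^sup>2) \<le> (\<Sum>m. ennreal (dyadic_majorant \<epsilon> u m))"
proof -
  obtain m where "2 ^ m \<le> N" "N < 2 ^ Suc m" using nat_in_dyadic_block[OF assms(3)] by blast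
  then have "ennreal ((\<epsilon> (real N) * cmod (\<Sum>n<N. u n))\<^sup>2) \<le> ennreal (dyadic_majorant \<epsilon> u m)"
    using assms by (intro ennreal_leI weighted_partial_sum_le_dyadic_majorant)
  also have "\<dots> \<le> (\<Sum>m. ennreal (dyadic_majorant \<epsilon> u m))"
    using sum_le_suminf[of "\<lambda>m. ennreal (dyadic_majorant \<epsilon> u m)" "{m}"] by simp
  finally show ?thesis .
qed

text \<open>The index m of the dyadic block containing N tends to infinity with N, and the terms of
  a convergent series tend to 0.\<close>

lemma weighted_partial_sum_tendsto_0:
  assumes "\<forall>t\<ge>0. 0 < \<epsilon> t" "antimono_on {0..} \<epsilon>"
    and fin: "(\<Sum>m. ennreal (dyadic_majorant \<epsilon> u m)) \<noteq> \<top>"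
  shows "(\<lambda>N. \<epsilon> (real N) * cmod (\<Sum>n<N. u n)) \<longlonglongrightarrow> 0"
proof (rule LIMSEQ_I)
  fix r :: real assume "0 < r"
  have "summable (dyadic_majorant \<epsilon> u)"
    by (rule summable_suminf_not_top[OF dyadic_majorant_nonneg fin])
  then have "dyadic_majorant \<epsilon> u \<longlonglongrightarrow> 0" by (rule summable_LIMSEQ_zero)
  then have "\<forall>\<^sub>F m in sequentially. dyadic_majorant \<epsilon> u m < r\<^sup>2"
    using \<open>0 < r\<close> by (intro order_tendstoD) auto
  then obtain m0 where m0: "\<And>m. m0 \<le> m \<Longrightarrow> dyadic_majorant \<epsilon> u m < r\<^sup>2"
    by (auto simp: eventually_sequentially)
  have "norm (\<epsilon> (real N) * cmod (\<Sum>n<N. u n) - 0) < r" if "2 ^ m0 \<le> N" for N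
  proof -
    have "1 \<le> N" using that by (meson one_le_numeral one_le_power order_trans)
    then obtain m where m: "2 ^ m \<le> N" "N < 2 ^ Suc m"
      using nat_in_dyadic_block by blast
    then have "(2::nat) ^ m0 < 2 ^ Suc m" using that by linarith
    then have "m0 \<le> m" by (simp del: power_Suc)
    have "(\<epsilon> (real N) * cmod (\<Sum>n<N. u n))\<^sup>2 < r\<^sup>2"
      using weighted_partial_sum_le_dyadic_majorant[OF assms(1,2) m, of u] m0[OF \<open>m0 \<le> m\<close>]
      by linarith
    moreover have "0 \<le> \<epsilon> (real N) * cmod (\<Sum>n<N. u n)"
      using assms(1) by (simp add: less_imp_le)
    ultimately show ?thesis
      using power_less_imp_less_base[of _ 2 r] \<open>0 < r\<close> by (simp only: real_norm_def diff_0_right abs_of_nonneg)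
  qed
  then show "\<exists>N0. \<forall>N\<ge>N0. norm (\<epsilon> (real N) * cmod (\<Sum>n<N. u n) - 0) < r"
    by blast
qed

lemma dyadic_majorant_nn_integral_le:
  assumes L2: "\<And>n. \<phi> n \<in> L2 M" and "0 \<le> C"
    and block: "\<And>a l. (L2_norm M (\<lambda>x. \<Sum>n\<in>{a..<a + l}. \<phi> n x))\<^sup>2 \<le> real l * C"
    and eps: "\<forall>t\<ge>0. 0 < \<epsilon> t" "antimono_on {0..} \<epsilon>"
  shows "(\<lambda>x. \<Sum>m. ennreal (dyadic_majorant \<epsilon> (\<lambda>n. \<phi> n x) m)) \<in> borel_measurable M"
    and "(\<integral>\<^sup>+x. (\<Sum>m. ennreal (dyadic_majorant \<epsilon> (\<lambda>n. \<phi> n x) m)) \<partial>M)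
      \<le> ennreal (36 / (ln 2)\<^sup>2 * C) * log_square_sum \<epsilon>"
proof -
  let ?G = "\<lambda>m x. dyadic_majorant \<epsilon> (\<lambda>n. \<phi> n x) m"
  let ?w = "\<lambda>m. (\<epsilon> (2 ^ m))\<^sup>2 * ((real m + 2)\<^sup>2 * 2 ^ Suc m)"
  let ?a = "\<lambda>n. (\<epsilon> (real n))\<^sup>2 * (ln (real n + 2))\<^sup>2"
  have int: "integrable M (?G m)" for m
    unfolding dyadic_majorant_def
    by (intro integrable_mult_right dyadic_square_sum_integral(1)[OF L2 block])
  then have meas: "(\<lambda>x. ennreal (?G m x)) \<in> borel_measurable M" for m
    using borel_measurable_integrable[OF int] by measurable
  then show "(\<lambda>x. \<Sum>m. ennreal (?G m x)) \<in> borel_measurable M"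
    by measurable
  have G: "(\<integral>\<^sup>+x. ennreal (?G m x) \<partial>M) \<le> ennreal (?w m * C)" for m
  proof -
    have "(\<integral>\<^sup>+x. ennreal (?G m x) \<partial>M) = ennreal (\<integral>x. ?G m x \<partial>M)"
      using int by (intro nn_integral_eq_integral) (auto simp: dyadic_majorant_nonneg)
    also have "(\<integral>x. ?G m x \<partial>M)
        = (\<epsilon> (2 ^ m))\<^sup>2 * ((real m + 2) * (\<integral>x. dyadic_square_sum (\<lambda>n. \<phi> n x) (Suc m) 0 \<partial>M))"
      unfolding dyadic_majorant_def by (simp del: dyadic_square_sum.simps)
    \<comment> \<open>One factor m + 2 is part of the majorant; the second,
      \<open>real (Suc m) + 1\<close>, counts the levels of a tree of depth
      \<open>Suc m\<close>.\<close>
    also have "\<dots> \<le> (\<epsilon> (2 ^ m))\<^sup>2 * ((real m + 2) * ((real (Suc m) + 1) * 2 ^ Suc m * C))"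
      by (intro mult_left_mono dyadic_square_sum_integral(2)[OF L2 block]) auto
    also have "\<dots> = ?w m * C" by (simp add: power2_eq_square algebra_simps)
    finally show ?thesis by (simp add: ennreal_leI)
  qed
  \<comment> \<open>Finite partial sums keep the weight comparison in the reals and cover a
    divergent \<open>log_square_sum \<epsilon>\<close> as well.\<close>
  have partial: "(\<Sum>m<p. ennreal (?w m * C)) \<le> ennreal (36 / (ln 2)\<^sup>2 * C) * log_square_sum \<epsilon>" for p
  proof -
    have "(\<Sum>m<p. ennreal (?w m * C)) = ennreal ((\<Sum>m<p. ?w m) * C)"
      using \<open>0 \<le> C\<close> by (simp add: sum_distrib_right)
    also have "(\<Sum>m<p. ?w m) * C \<le> (\<Sum>m\<le>p. ?w m) * C"
      using \<open>0 \<le> C\<close> by (intro mult_right_mono sum_mono2) auto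
    also have "\<dots> \<le> (36 / (ln 2)\<^sup>2 * (\<Sum>n<2 ^ p. ?a n)) * C"
      using \<open>0 \<le> C\<close> by (intro mult_right_mono dyadic_weight_sum_le eps)
    finally have "(\<Sum>m<p. ennreal (?w m * C))
        \<le> ennreal (36 / (ln 2)\<^sup>2 * C * (\<Sum>n<2 ^ p. ?a n))"
      by (simp add: ennreal_leI mult_ac)
    also have "\<dots> = ennreal (36 / (ln 2)\<^sup>2 * C) * (\<Sum>n<2 ^ p. ennreal (?a n))"
      using \<open>0 \<le> C\<close> by (subst ennreal_mult) (auto intro: sum_nonneg simp: sum_ennreal)
    also have "\<dots> \<le> ennreal (36 / (ln 2)\<^sup>2 * C) * log_square_sum \<epsilon>"
      unfolding log_square_sum_def by (intro mult_left_mono sum_le_suminf) auto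
    finally show ?thesis .
  qed
  have "(\<integral>\<^sup>+x. (\<Sum>m. ennreal (?G m x)) \<partial>M) = (\<Sum>m. \<integral>\<^sup>+x. ennreal (?G m x) \<partial>M)"
    by (rule nn_integral_suminf[OF meas])
  also have "\<dots> \<le> (\<Sum>m. ennreal (?w m * C))"
    using G by (intro suminf_le) auto
  also have "\<dots> \<le> ennreal (36 / (ln 2)\<^sup>2 * C) * log_square_sum \<epsilon>"
    unfolding suminf_eq_SUP by (rule SUP_least) (rule partial)
  finally show "(\<integral>\<^sup>+x. (\<Sum>m. ennreal (?G m x)) \<partial>M)
      \<le> ennreal (36 / (ln 2)\<^sup>2 * C) * log_square_sum \<epsilon>" .
qed

section \<open>From the majorants to the maximal operator\<close>

lemma weighted_deviation_eq:
  "weighted_deviation \<epsilon> F P N x = \<epsilon> (real N) * cmod (\<Sum>n<N. F n x - P x)"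
proof (cases "N = 0")
  case False
  \<comment> \<open>The outer factor N turns the mean into a sum and \<open>P x\<close> into N
    copies, one for each term. For N = 0 both sides of the claim vanish.\<close>
  have "cmod (\<Sum>n<N. F n x - P x) = cmod (of_nat N * (1 / of_nat N * (\<Sum>n<N. F n x) - P x))"
    using False by (simp add: sum_subtractf right_diff_distrib)
  then show ?thesis
    by (simp add: weighted_deviation_def norm_mult mult_ac)
qed (simp add: weighted_deviation_def)

lemma ennreal_sqrt_mono: "s \<le> t \<Longrightarrow> ennreal_sqrt s \<le> ennreal_sqrt t"
  by (auto simp: ennreal_sqrt_def top_unique less_top intro!: ennreal_leI enn2real_mono)

lemma ennreal_sqrt_ennreal: "0 \<le> t \<Longrightarrow> ennreal_sqrt (ennreal t) = ennreal (sqrt t)"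
  by (simp add: ennreal_sqrt_def)

lemma maximal_operator_square_le:
  assumes eps: "\<forall>t\<ge>0. 0 < \<epsilon> t" "antimono_on {0..} \<epsilon>"
  shows "(maximal_operator \<epsilon> F P x)\<^sup>2 \<le> (\<Sum>m. ennreal (dyadic_majorant \<epsilon> (\<lambda>n. F n x - P x) m))"
    (is "_ \<le> ?G")
proof (cases ?G)
  case (real g)
  have "weighted_deviation \<epsilon> F P N x \<le> sqrt g" if "1 \<le> N" for N
    using weighted_partial_sum_le_suminf[OF eps that, of "\<lambda>n. F n x - P x"] real
    by (intro real_le_rsqrt) (simp add: weighted_deviation_eq)
  then have "maximal_operator \<epsilon> F P x \<le> ennreal (sqrt g)"
    unfolding maximal_operator_def by (intro SUP_least ennreal_leI) auto
  then have "(maximal_operator \<epsilon> F P x)\<^sup>2 \<le> (ennreal (sqrt g))\<^sup>2"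
    by (rule power_mono) simp
  with real show ?thesis by (simp add: ennreal_power)
qed simp

lemma maximal_operator_norm_le:
  assumes L2: "\<And>n. F n \<in> L2 M" "P \<in> L2 M" and "0 \<le> B"
    and block: "\<And>a l. (L2_norm M (\<lambda>x. \<Sum>n\<in>{a..<a + l}. F n x - P x))\<^sup>2 \<le> real l * B\<^sup>2"
    and eps: "\<forall>t\<ge>0. 0 < \<epsilon> t" "antimono_on {0..} \<epsilon>"
  shows "L2_ennnorm M (maximal_operator \<epsilon> F P)
    \<le> ennreal (6 / ln 2) * ennreal_sqrt (log_square_sum \<epsilon>) * ennreal B"
proof (cases "B = 0")
  \<comment> \<open>Here the right-hand side is 0 even if \<open>log_square_sum \<epsilon>\<close>
    is infinite, by the convention \<open>\<infinity> * 0 = 0\<close>, so the maximal operator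
    itself must vanish almost everywhere. The block bound gives this for each N, and there are
    countably many N.\<close>
  case True
  have "AE x in M. (\<Sum>n<N. F n x - P x) = 0" for N
  proof -
    have "(L2_norm M (\<lambda>x. \<Sum>n<N. F n x - P x))\<^sup>2 \<le> 0"
      using block[of 0 N] True by (simp add: lessThan_atLeast0)
    then have "L2_norm M (\<lambda>x. \<Sum>n<N. F n x - P x) = 0" by simp
    moreover have "(\<lambda>x. \<Sum>n<N. F n x - P x) \<in> L2 M" by (intro L2_sum L2_diff L2)
    ultimately show ?thesis by (simp add: L2_norm_eq_0_iff)
  qed
  then have "AE x in M. \<forall>N. (\<Sum>n<N. F n x - P x) = 0" by (simp add: AE_all_countable)
  then have "AE x in M. (maximal_operator \<epsilon> F P x)\<^sup>2 = 0"
    by eventually_elim (simp add: maximal_operator_def weighted_deviation_eq)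
  then have "(\<integral>\<^sup>+x. (maximal_operator \<epsilon> F P x)\<^sup>2 \<partial>M) = (\<integral>\<^sup>+x. 0 \<partial>M)"
    by (rule nn_integral_cong_AE)
  then show ?thesis by (simp add: L2_ennnorm_def ennreal_sqrt_def)
next
  case False
  with \<open>0 \<le> B\<close> have "0 < B" by simp
  show ?thesis
  proof (cases "log_square_sum \<epsilon>")
    case (real l)
    have "(\<integral>\<^sup>+x. (maximal_operator \<epsilon> F P x)\<^sup>2 \<partial>M)
        \<le> (\<integral>\<^sup>+x. (\<Sum>m. ennreal (dyadic_majorant \<epsilon> (\<lambda>n. F n x - P x) m)) \<partial>M)"
      by (intro nn_integral_mono maximal_operator_square_le eps)
    also have "\<dots> \<le> ennreal (36 / (ln 2)\<^sup>2 * B\<^sup>2) * log_square_sum \<epsilon>"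
      using L2 by (intro dyadic_majorant_nn_integral_le(2) block eps L2_diff) auto
    also have "\<dots> = ennreal (36 / (ln 2)\<^sup>2 * B\<^sup>2 * l)"
      using real by (subst ennreal_mult) auto
    finally have "L2_ennnorm M (maximal_operator \<epsilon> F P)
        \<le> ennreal_sqrt (ennreal (36 / (ln 2)\<^sup>2 * B\<^sup>2 * l))"
      unfolding L2_ennnorm_def by (rule ennreal_sqrt_mono)
    also have "\<dots> = ennreal (6 / ln 2 * sqrt l * B)"
    proof -
      have "36 / (ln 2)\<^sup>2 * B\<^sup>2 * l = (6 / ln 2 * B)\<^sup>2 * l"
        by (simp add: power_mult_distrib power_divide)
      then have "sqrt (36 / (ln 2)\<^sup>2 * B\<^sup>2 * l) = 6 / ln 2 * sqrt l * B"
        using \<open>0 < B\<close> by (simp add: real_sqrt_mult)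
      then show ?thesis using real \<open>0 < B\<close> by (simp add: ennreal_sqrt_ennreal)
    qed
    also have "\<dots> = ennreal (6 / ln 2) * ennreal_sqrt (log_square_sum \<epsilon>) * ennreal B"
      using real \<open>0 < B\<close> by (simp only: ennreal_sqrt_ennreal) (simp flip: ennreal_mult)
    finally show ?thesis .
  next
    \<comment> \<open>As B is positive, the right-hand side is infinite.\<close>
    case top
    then show ?thesis
      using \<open>0 < B\<close> by (simp add: ennreal_sqrt_def ennreal_mult_top ennreal_top_mult)
  qed
qed

lemma weighted_deviation_tendsto_0:
  assumes L2: "\<And>n. F n \<in> L2 M" "P \<in> L2 M" and "0 \<le> B"
    and block: "\<And>a l. (L2_norm M (\<lambda>x. \<Sum>n\<in>{a..<a + l}. F n x - P x))\<^sup>2 \<le> real l * B\<^sup>2"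
    and eps: "\<forall>t\<ge>0. 0 < \<epsilon> t" "antimono_on {0..} \<epsilon>"
    and fin: "log_square_sum \<epsilon> < \<top>"
  shows "AE x in M. (\<lambda>N. weighted_deviation \<epsilon> F P N x) \<longlonglongrightarrow> 0"
proof -
  let ?G = "\<lambda>x. \<Sum>m. ennreal (dyadic_majorant \<epsilon> (\<lambda>n. F n x - P x) m)"
  have L: "(\<lambda>x. F n x - P x) \<in> L2 M" for n using L2 by (intro L2_diff)
  note G = dyadic_majorant_nn_integral_le[OF L zero_le_power2 block eps]
  have "(\<integral>\<^sup>+x. ?G x \<partial>M) < \<top>"
    using fin by (intro le_less_trans[OF G(2)]) (simp add: ennreal_mult_less_top)
  then have "AE x in M. ?G x \<noteq> \<top>"
    using nn_integral_PInf_AE[OF G(1)] by auto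
  then show ?thesis
    by eventually_elim (simp add: weighted_deviation_eq weighted_partial_sum_tendsto_0[OF eps])
qed

subsection \<open>Orbits of an isometry\<close>

lemma L2_norm_eqI_inner:
  assumes "L2_inner M f f = L2_inner M g g"
  shows "L2_norm M f = L2_norm M g"
proof -
  have "complex_of_real ((L2_norm M f)\<^sup>2) = of_real ((L2_norm M g)\<^sup>2)"
    using assms by (simp only: L2_inner_self)
  then have "(L2_norm M f)\<^sup>2 = (L2_norm M g)\<^sup>2" by (rule of_real_eq_iff[THEN iffD1])
  then show ?thesis by (simp add: L2_norm_nonneg)
qed

lemma L2_isometry_norm:
  assumes "L2_isometry M W T" "f \<in> W"
  shows "L2_norm M (T f) = L2_norm M f"
  using assms by (intro L2_norm_eqI_inner) (simp add: L2_isometry_def)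

lemma L2_isometryD:
  assumes "L2_isometry M (L2 M) T"
  shows "f \<in> L2 M \<Longrightarrow> T f \<in> L2 M"
    and "f \<in> L2 M \<Longrightarrow> g \<in> L2 M \<Longrightarrow> L2_eq M f g \<Longrightarrow> L2_eq M (T f) (T g)"
    and "f \<in> L2 M \<Longrightarrow> g \<in> L2 M \<Longrightarrow> L2_eq M (T (\<lambda>x. f x + g x)) (\<lambda>x. T f x + T g x)"
    and "f \<in> L2 M \<Longrightarrow> L2_eq M (T (\<lambda>x. a * f x)) (\<lambda>x. a * T f x)"
    and "f \<in> L2 M \<Longrightarrow> g \<in> L2 M \<Longrightarrow> L2_inner M (T f) (T g) = L2_inner M f g"
  using assms unfolding L2_isometry_def L2_bounded_operator_def by blast+

lemma L2_isometryI:
  assumes "\<And>f. f \<in> L2 M \<Longrightarrow> T f \<in> L2 M"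
    and "\<And>f g. f \<in> L2 M \<Longrightarrow> g \<in> L2 M \<Longrightarrow> L2_eq M f g \<Longrightarrow> L2_eq M (T f) (T g)"
    and "\<And>f g. f \<in> L2 M \<Longrightarrow> g \<in> L2 M \<Longrightarrow> L2_eq M (T (\<lambda>x. f x + g x)) (\<lambda>x. T f x + T g x)"
    and "\<And>a f. f \<in> L2 M \<Longrightarrow> L2_eq M (T (\<lambda>x. a * f x)) (\<lambda>x. a * T f x)"
    and inner: "\<And>f g. f \<in> L2 M \<Longrightarrow> g \<in> L2 M \<Longrightarrow> L2_inner M (T f) (T g) = L2_inner M f g"
  shows "L2_isometry M (L2 M) T"
proof -
  have "L2_norm M (T f) \<le> 1 * L2_norm M f" if "f \<in> L2 M" for f
    using L2_norm_eqI_inner[OF inner[OF that that]] by simp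
  then have "\<exists>B. \<forall>f\<in>L2 M. L2_norm M (T f) \<le> B * L2_norm M f" by blast
  with assms show ?thesis
    unfolding L2_isometry_def L2_bounded_operator_def by simp
qed

text \<open>The laws of T hold only up to a.e. equality, so each law of \<open>T ^^ n\<close> is
  passed through one more T by congruence and then combined with the law of T.\<close>

lemma L2_isometry_funpow:
  assumes T: "L2_isometry M (L2 M) T"
  shows "L2_isometry M (L2 M) (T ^^ n)"
proof (induction n)
  case 0
  show ?case by (rule L2_isometryI) (auto simp: L2_eq_def)
next
  case (Suc n)
  note T = L2_isometryD[OF T] and IH = L2_isometryD[OF Suc.IH]
  show ?case
  proof (rule L2_isometryI)
    fix f g :: "'a \<Rightarrow> complex" assume fg: "f \<in> L2 M" "g \<in> L2 M"
    have "L2_eq M (T ((T ^^ n) (\<lambda>x. f x + g x))) (T (\<lambda>x. (T ^^ n) f x + (T ^^ n) g x))"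
      using fg by (intro T(2) IH L2_add)
    then show "L2_eq M ((T ^^ Suc n) (\<lambda>x. f x + g x)) (\<lambda>x. (T ^^ Suc n) f x + (T ^^ Suc n) g x)"
      using T(3)[OF IH(1)[OF fg(1)] IH(1)[OF fg(2)]] by (auto intro: L2_eq_trans)
  next
    fix a and f :: "'a \<Rightarrow> complex" assume f: "f \<in> L2 M"
    have "L2_eq M (T ((T ^^ n) (\<lambda>x. a * f x))) (T (\<lambda>x. a * (T ^^ n) f x))"
      using f by (intro T(2) IH L2_cmult)
    then show "L2_eq M ((T ^^ Suc n) (\<lambda>x. a * f x)) (\<lambda>x. a * (T ^^ Suc n) f x)"
      using T(4)[OF IH(1)[OF f]] by (auto intro: L2_eq_trans)
  qed (use T(1,2,5) IH(1,2,5) in auto)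
qed

lemma L2_isometry_sum:
  assumes T: "L2_isometry M (L2 M) T" and f: "\<And>i. i \<in> I \<Longrightarrow> f i \<in> L2 M"
  shows "L2_eq M (T (\<lambda>x. \<Sum>i\<in>I. f i x)) (\<lambda>x. \<Sum>i\<in>I. T (f i) x)"
proof -
  note T = L2_isometryD[OF T]
  \<comment> \<open>Homogeneity with the scalar 0. This settles the empty sum and also an infinite
    I, over which sums are 0 by convention.\<close>
  have zero: "L2_eq M (T (\<lambda>x. 0)) (\<lambda>x. 0)"
    using T(4)[OF L2_zero, of 0] by simp
  show ?thesis using f
  proof (induction I rule: infinite_finite_induct)
    case (insert i I)
    have "L2_eq M (T (\<lambda>x. f i x + (\<Sum>i\<in>I. f i x))) (\<lambda>x. T (f i) x + T (\<lambda>x. \<Sum>i\<in>I. f i x) x)"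
      using insert.prems by (intro T(3) L2_sum) auto
    moreover have "L2_eq M (\<lambda>x. T (f i) x + T (\<lambda>x. \<Sum>i\<in>I. f i x) x)
        (\<lambda>x. T (f i) x + (\<Sum>i\<in>I. T (f i) x))"
      using insert by (intro L2_eq_add L2_eq_refl) auto
    ultimately show ?case
      using insert.hyps by (auto intro: L2_eq_trans)
  qed (auto simp: zero)
qed

text \<open>Pythagoras for l vectors that all have the norm of u.\<close>

lemma L2_norm_orthogonal_orbit_sum:
  assumes T: "L2_isometry M (L2 M) T" and u: "u \<in> L2 M"
    and orth: "\<And>m n. m \<noteq> n \<Longrightarrow> L2_inner M ((T ^^ m) u) ((T ^^ n) u) = 0"
  shows "L2_norm M (\<lambda>x. \<Sum>n\<in>{a..<a + l}. (T ^^ n) u x) = sqrt (real l) * L2_norm M u"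
proof -
  note Tn = L2_isometry_funpow[OF T]
  have "(L2_norm M (\<lambda>x. \<Sum>n\<in>{a..<a + l}. (T ^^ n) u x))\<^sup>2
      = (\<Sum>n\<in>{a..<a + l}. (L2_norm M ((T ^^ n) u))\<^sup>2)"
    by (intro L2_norm_orthogonal_sum orth L2_isometryD(1)[OF Tn] u) auto
  also have "\<dots> = (sqrt (real l) * L2_norm M u)\<^sup>2"
    by (simp add: L2_isometry_norm[OF Tn u] power_mult_distrib)
  finally show ?thesis
    by (simp add: L2_norm_nonneg)
qed

text \<open>Norms are added over k, but for each single k the orthogonality along the orbit yields
  \<open>sqrt (real l)\<close> instead of l. This is done for finitely many k; a limit removes the
  remainder of the expansion.\<close>

lemma L2_norm_orbit_sum_le:
  assumes T: "L2_isometry M (L2 M) T" and g: "g \<in> L2 M" and u: "\<And>k. k \<in> K \<Longrightarrow> u k \<in> L2 M"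
    and lim: "((\<lambda>F. L2_norm M (\<lambda>x. g x - (\<Sum>k\<in>F. u k x))) \<longlongrightarrow> 0) (finite_subsets_at_top K)"
    and orth: "\<And>k m n. k \<in> K \<Longrightarrow> m \<noteq> n \<Longrightarrow> L2_inner M ((T ^^ m) (u k)) ((T ^^ n) (u k)) = 0"
    and B: "\<And>F. finite F \<Longrightarrow> F \<subseteq> K \<Longrightarrow> (\<Sum>k\<in>F. L2_norm M (u k)) \<le> B"
  shows "L2_norm M (\<lambda>x. \<Sum>n\<in>{a..<a + l}. (T ^^ n) g x) \<le> sqrt (real l) * B"
proof -
  note Tn = L2_isometry_funpow[OF T] and Tn_L2 = L2_isometryD(1)[OF L2_isometry_funpow[OF T]]
  let ?I = "{a..<a + l}"
  \<comment> \<open>The remainder only gets the crude factor l from the triangle inequality. This is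
    harmless: l is fixed while F grows and the norm of the remainder tends to 0.\<close>
  have approx: "L2_norm M (\<lambda>x. \<Sum>n\<in>?I. (T ^^ n) g x)
      \<le> real l * L2_norm M (\<lambda>x. g x - (\<Sum>k\<in>F. u k x)) + sqrt (real l) * B"
    if F: "finite F" "F \<subseteq> K" for F
  proof -
    define s where "s = (\<lambda>x. \<Sum>k\<in>F. u k x)"
    define r where "r = (\<lambda>x. g x - s x)"
    have uF: "u k \<in> L2 M" if "k \<in> F" for k using that F u by auto
    have s: "s \<in> L2 M" unfolding s_def by (intro L2_sum uF)
    have r: "r \<in> L2 M" unfolding r_def by (intro L2_diff g s)
    have "g = (\<lambda>x. r x + s x)" by (simp add: r_def)
    then have split: "L2_eq M ((T ^^ n) g) (\<lambda>x. (T ^^ n) r x + (T ^^ n) s x)" for n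
      using L2_isometryD(3)[OF Tn r s] by simp
    have "L2_eq M ((T ^^ n) s) (\<lambda>x. \<Sum>k\<in>F. (T ^^ n) (u k) x)" for n
      unfolding s_def by (intro L2_isometry_sum[OF Tn] uF)
    then have "L2_eq M ((T ^^ n) g) (\<lambda>x. (T ^^ n) r x + (\<Sum>k\<in>F. (T ^^ n) (u k) x))" for n
      by (rule L2_eq_trans[OF split L2_eq_add[OF L2_eq_refl]])
    then have "L2_eq M (\<lambda>x. \<Sum>n\<in>?I. (T ^^ n) g x)
        (\<lambda>x. \<Sum>n\<in>?I. (T ^^ n) r x + (\<Sum>k\<in>F. (T ^^ n) (u k) x))"
      by (rule L2_eq_sum)
    also have "(\<lambda>x. \<Sum>n\<in>?I. (T ^^ n) r x + (\<Sum>k\<in>F. (T ^^ n) (u k) x))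
        = (\<lambda>x. (\<Sum>n\<in>?I. (T ^^ n) r x) + (\<Sum>k\<in>F. \<Sum>n\<in>?I. (T ^^ n) (u k) x))" (is "_ = ?h")
      by (simp add: sum.distrib sum.swap[of _ ?I F])
    finally have "L2_norm M (\<lambda>x. \<Sum>n\<in>?I. (T ^^ n) g x) = L2_norm M ?h"
      by (intro L2_norm_cong L2_add L2_sum Tn_L2 g r uF)
    also have "\<dots> \<le> L2_norm M (\<lambda>x. \<Sum>n\<in>?I. (T ^^ n) r x)
        + L2_norm M (\<lambda>x. \<Sum>k\<in>F. \<Sum>n\<in>?I. (T ^^ n) (u k) x)"
      by (intro L2_norm_triangle L2_sum Tn_L2 r uF)
    also have "\<dots> \<le> (\<Sum>n\<in>?I. L2_norm M ((T ^^ n) r))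
        + (\<Sum>k\<in>F. L2_norm M (\<lambda>x. \<Sum>n\<in>?I. (T ^^ n) (u k) x))"
      by (intro add_mono L2_norm_sum_le L2_sum Tn_L2 r uF)
    also have "\<dots> = real l * L2_norm M r + (\<Sum>k\<in>F. sqrt (real l) * L2_norm M (u k))"
    proof (intro arg_cong2[of _ _ _ _ "(+)"] sum.cong refl)
      show "(\<Sum>n\<in>?I. L2_norm M ((T ^^ n) r)) = real l * L2_norm M r"
        by (simp add: L2_isometry_norm[OF Tn r])
      show "L2_norm M (\<lambda>x. \<Sum>n\<in>?I. (T ^^ n) (u k) x) = sqrt (real l) * L2_norm M (u k)"
        if "k \<in> F" for k
        by (rule L2_norm_orthogonal_orbit_sum[OF T uF[OF that]]) (use orth that F in auto)
    qed
    also have "\<dots> \<le> real l * L2_norm M r + sqrt (real l) * B"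
      using B[OF F] by (simp add: mult_left_mono flip: sum_distrib_left)
    finally show ?thesis by (simp add: r_def s_def)
  qed
  have "((\<lambda>F. real l * L2_norm M (\<lambda>x. g x - (\<Sum>k\<in>F. u k x)) + sqrt (real l) * B)
      \<longlongrightarrow> real l * 0 + sqrt (real l) * B) (finite_subsets_at_top K)"
    by (intro tendsto_intros lim)
  then have "((\<lambda>F. real l * L2_norm M (\<lambda>x. g x - (\<Sum>k\<in>F. u k x)) + sqrt (real l) * B)
      \<longlongrightarrow> sqrt (real l) * B) (finite_subsets_at_top K)"
    by simp
  then show ?thesis
    by (rule tendsto_lowerbound)
      (auto intro!: eventually_finite_subsets_at_top_weakI approx)
qed

text \<open>In a finite partial sum containing the index k only that term survives the pairing with
  h, and Cauchy--Schwarz controls the remainder of the expansion.\<close>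

lemma L2_inner_orthogonal_expansion:
  assumes g: "g \<in> L2 M" and u: "\<And>k. k \<in> K \<Longrightarrow> u k \<in> L2 M" and h: "h \<in> L2 M" and k: "k \<in> K"
    and lim: "((\<lambda>F. L2_norm M (\<lambda>x. g x - (\<Sum>k\<in>F. u k x))) \<longlongrightarrow> 0) (finite_subsets_at_top K)"
    and orth: "\<And>j. j \<in> K \<Longrightarrow> j \<noteq> k \<Longrightarrow> L2_inner M (u j) h = 0"
  shows "L2_inner M g h = L2_inner M (u k) h"
proof -
  have bound: "cmod (L2_inner M g h - L2_inner M (u k) h)
      \<le> L2_norm M (\<lambda>x. g x - (\<Sum>k\<in>F. u k x)) * L2_norm M h"
    if F: "finite F" "F \<subseteq> K" "k \<in> F" for F
  proof -
    have uF: "u j \<in> L2 M" if "j \<in> F" for j using that F u by auto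
    have "L2_inner M (\<lambda>x. \<Sum>j\<in>F. u j x) h = (\<Sum>j\<in>F. L2_inner M (u j) h)"
      by (intro L2_inner_sum_left uF h)
    also have "\<dots> = (\<Sum>j\<in>F. if j = k then L2_inner M (u k) h else 0)"
      using F orth by (intro sum.cong) auto
    also have "\<dots> = L2_inner M (u k) h"
      using F by simp
    finally have "L2_inner M g h - L2_inner M (u k) h = L2_inner M (\<lambda>x. g x - (\<Sum>j\<in>F. u j x)) h"
      using L2_inner_diff_left[OF g L2_sum[of F u M] h] uF by simp
    then show ?thesis
      using L2_Cauchy_Schwarz[OF L2_diff[OF g L2_sum[of F u M]] h] uF by simp
  qed
  have "((\<lambda>F. L2_norm M (\<lambda>x. g x - (\<Sum>k\<in>F. u k x)) * L2_norm M h)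
      \<longlongrightarrow> 0 * L2_norm M h) (finite_subsets_at_top K)"
    by (intro tendsto_intros lim)
  then have "cmod (L2_inner M g h - L2_inner M (u k) h) \<le> 0 * L2_norm M h"
  proof (rule tendsto_lowerbound)
    show "\<forall>\<^sub>F F in finite_subsets_at_top K. cmod (L2_inner M g h - L2_inner M (u k) h)
        \<le> L2_norm M (\<lambda>x. g x - (\<Sum>k\<in>F. u k x)) * L2_norm M h"
      unfolding eventually_finite_subsets_at_top
      using k bound by (intro exI[of _ "{k}"]) auto
  qed simp
  then show ?thesis by simp
qed

section \<open>Integer powers of the shift\<close>

lemma funpow_invariant:
  assumes "\<And>x. x \<in> A \<Longrightarrow> f x \<in> A" "x \<in> A"
  shows "(f ^^ n) x \<in> A"
  using assms by (induction n) auto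

lemma L2_inverse_works:
  assumes "L2_unitary M W T" "w \<in> W"
  shows "L2_inverse M W T w \<in> W" "L2_eq M (T (L2_inverse M W T w)) w"
proof -
  have "\<exists>f. f \<in> W \<and> L2_eq M (T f) w"
    using assms by (auto simp: L2_unitary_def)
  from someI_ex[OF this]
  show "L2_inverse M W T w \<in> W" "L2_eq M (T (L2_inverse M W T w)) w"
    by (auto simp: L2_inverse_def)
qed

lemma funpow_L2_inverse:
  assumes T: "L2_isometry M (L2 M) T" and "W \<subseteq> L2 M" "L2_unitary M W T" "w \<in> W"
  shows "L2_eq M ((T ^^ j) ((L2_inverse M W T ^^ j) w)) w"
proof (induction j)
  case 0
  show ?case by (simp add: L2_eq_refl)
next
  case (Suc j)
  let ?S = "L2_inverse M W T"
  define y where "y = (?S ^^ j) w"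
  have y: "y \<in> W" unfolding y_def
    using assms by (intro funpow_invariant) (auto intro: L2_inverse_works)
  note Sy = L2_inverse_works[OF assms(3) y]
  \<comment> \<open>The innermost T is placed next to the outermost inverse, so that one pair
    cancels and the exponent j remains.\<close>
  have "(T ^^ Suc j) ((?S ^^ Suc j) w) = (T ^^ j) (T (?S y))"
    by (simp add: funpow_swap1 y_def)
  moreover have "L2_eq M ((T ^^ j) (T (?S y))) ((T ^^ j) y)"
    using Sy y assms(2) by (intro L2_isometryD(2)[OF L2_isometry_funpow[OF T]] L2_isometryD(1)[OF T]) auto
  ultimately show ?case
    using Suc.IH by (auto simp: y_def intro: L2_eq_trans)
qed

lemma L2_power_in:
  assumes inv: "\<forall>f\<in>W. T f \<in> W" and k: "k < 0 \<Longrightarrow> L2_unitary M W T" and v: "v \<in> W"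
  shows "L2_power M W T k v \<in> W"
  using assms unfolding L2_power_def by (auto intro!: funpow_invariant L2_inverse_works(1))

text \<open>Some power \<open>T ^^ j\<close> moves u into the forward orbit of v and preserves inner
  products, so the orbit of u inherits the orthogonality of the orbit of v.\<close>

lemma L2_power_orbit_orthogonal:
  assumes T: "L2_isometry M (L2 M) T" and W: "W \<subseteq> L2 M" "\<forall>f\<in>W. T f \<in> W"
    and k: "k < 0 \<Longrightarrow> L2_unitary M W T"
    and v: "v \<in> W" "\<And>m n. m \<noteq> n \<Longrightarrow> L2_inner M ((T ^^ m) v) ((T ^^ n) v) = 0"
    and u: "u \<in> L2 M" "L2_eq M (L2_power M W T k v) u"
    and "m \<noteq> n"
  shows "L2_inner M ((T ^^ m) u) ((T ^^ n) u) = 0"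
proof -
  note Tn = L2_isometry_funpow[OF T]
  note Tn_L2 = L2_isometryD(1)[OF Tn] and Tn_cong = L2_isometryD(2)[OF Tn]
  have pow: "L2_power M W T k v \<in> L2 M" using L2_power_in[OF W(2) k v(1)] W(1) by auto
  have vL: "v \<in> L2 M" using v W by auto
  \<comment> \<open>For nonnegative k take \<open>j = 0\<close> and \<open>i = nat k\<close>;
    otherwise \<open>j = nat (- k)\<close> and \<open>i = 0\<close>, as the powers of T undo those
    of its inverse.\<close>
  obtain i j where ij: "L2_eq M ((T ^^ j) u) ((T ^^ i) v)"
  proof (cases "0 \<le> k")
    case True
    with u(2) have "L2_eq M ((T ^^ 0) u) ((T ^^ nat k) v)"
      by (simp add: L2_power_def L2_eq_sym)
    then show ?thesis by (rule that)
  next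
    case False
    then have "L2_eq M ((T ^^ nat (- k)) (L2_power M W T k v)) v"
      using funpow_L2_inverse[OF T W(1) k v(1)] by (simp add: L2_power_def)
    moreover have "L2_eq M ((T ^^ nat (- k)) u) ((T ^^ nat (- k)) (L2_power M W T k v))"
      by (intro Tn_cong u pow L2_eq_sym)
    ultimately have "L2_eq M ((T ^^ nat (- k)) u) ((T ^^ 0) v)"
      by (auto intro: L2_eq_trans)
    then show ?thesis by (rule that)
  qed
  have shift: "L2_eq M ((T ^^ j) ((T ^^ n) u)) ((T ^^ (n + i)) v)" for n
  proof -
    have "(T ^^ j) ((T ^^ n) u) = (T ^^ n) ((T ^^ j) u)"
      by (metis add.commute comp_apply funpow_add)
    moreover have "(T ^^ (n + i)) v = (T ^^ n) ((T ^^ i) v)" by (simp add: funpow_add)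
    ultimately show ?thesis using Tn_cong[OF Tn_L2[OF u(1)] Tn_L2[OF vL] ij] by simp
  qed
  have "L2_inner M ((T ^^ m) u) ((T ^^ n) u) = L2_inner M ((T ^^ j) ((T ^^ m) u)) ((T ^^ j) ((T ^^ n) u))"
    by (intro L2_isometryD(5)[OF Tn, symmetric] Tn_L2 u)
  also have "\<dots> = L2_inner M ((T ^^ (m + i)) v) ((T ^^ (n + i)) v)"
    by (intro L2_inner_cong shift Tn_L2 u vL)
  also have "\<dots> = 0" using \<open>m \<noteq> n\<close> by (intro v(2)) simp
  finally show ?thesis .
qed

subsection \<open>The ergodic maximal inequality\<close>

text \<open>This excludes the product \<open>0 * \<top>\<close> when \<open>shift_norm_sum\<close>
  is infinite. The term n = 0 is already positive, since \<open>\<epsilon> 0\<close> and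
  \<open>ln 2\<close> are.\<close>

lemma ennreal_sqrt_log_square_sum_pos:
  assumes "\<forall>t\<ge>0. 0 < \<epsilon> t"
  shows "0 < ennreal_sqrt (log_square_sum \<epsilon>)"
proof -
  let ?a = "\<lambda>n. ennreal ((\<epsilon> (real n))\<^sup>2 * (ln (real n + 2))\<^sup>2)"
  have "0 < \<epsilon> 0" using assms by simp
  then have "0 < (\<epsilon> (real 0))\<^sup>2 * (ln (real 0 + 2))\<^sup>2" by simp
  then have "0 < ?a 0" by (simp only: ennreal_less_zero_iff)
  also have "?a 0 \<le> log_square_sum \<epsilon>"
    unfolding log_square_sum_def using sum_le_suminf[of ?a "{0}"]
    by (simp only: summableI finite.intros sum.insert sum.empty empty_iff not_False_eq_True
        add_0_right zero_le simp_thms ball_simps)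
  finally have "0 < log_square_sum \<epsilon>" .
  then show ?thesis
    by (cases "log_square_sum \<epsilon>") (auto simp: ennreal_sqrt_def)
qed

text \<open>For f = g + h the difference of \<open>F n\<close> and P represents
  \<open>(T ^^ n) g\<close>, because T fixes h and h is the projection of f onto the complement of
  W. The components of g have the norms that are summed in B, so \<open>L2_norm_orbit_sum_le\<close>
  applies.\<close>

lemma shift_orbit_block_le:
  assumes iso: "L2_isometry M (L2 M) T"
    and W: "L2_closed_subspace M W"
    and split: "\<forall>f\<in>L2 M. \<exists>g\<in>W. \<exists>h\<in>L2_perp M W. L2_eq M f (\<lambda>x. g x + h x)"
    and inv: "\<forall>f\<in>W. T f \<in> W" "\<forall>f\<in>L2_perp M W. T f \<in> L2_perp M W"
    and shift: "unilateral_shift M W T \<and> K = {0..} \<or> bilateral_shift M W T \<and> K = UNIV"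
    and fix_perp: "\<forall>f\<in>L2_perp M W. L2_eq M (T f) f"
    and gen: "generating_wandering M W T K V"
    and f: "f \<in> L2 M"
    and rep: "representatives M W T f F P"
    and B: "shift_norm_sum M W T K V f = ennreal B" "0 \<le> B"
  shows "(L2_norm M (\<lambda>x. \<Sum>n\<in>{a..<a + l}. F n x - P x))\<^sup>2 \<le> real l * B\<^sup>2"
proof -
  define H where "H = (\<lambda>k. L2_image M (L2_power M W T k) V)"
  note Tn = L2_isometry_funpow[OF iso]
  note Tn_L2 = L2_isometryD(1)[OF Tn] and Tn_cong = L2_isometryD(2)[OF Tn]
  have WL: "W \<subseteq> L2 M" using W by (simp add: L2_closed_subspace_def)
  have perpL: "L2_perp M W \<subseteq> L2 M" by (auto simp: L2_perp_def)
  have W_sat: "g \<in> W" if "f \<in> W" "g \<in> L2 M" "L2_eq M f g" for f g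
    using W that unfolding L2_closed_subspace_def by blast
  have unitary: "L2_unitary M W T" if "k \<in> K" "k < 0" for k
    using shift that by (auto simp: bilateral_shift_def)
  have nonneg_K: "0 \<le> k \<Longrightarrow> k \<in> K" for k using shift by auto
  have VW: "V \<subseteq> W" and W_sum: "W = L2_direct_sum M K H"
    and H_orth: "\<And>j k. j \<in> K \<Longrightarrow> k \<in> K \<Longrightarrow> j \<noteq> k \<Longrightarrow> L2_ortho M (H j) (H k)"
    using gen by (auto simp: generating_wandering_def H_def)
  have HL: "H k \<subseteq> L2 M" for k by (auto simp: H_def L2_image_def)
  have HW: "H k \<subseteq> W" if "k \<in> K" for k
    unfolding H_def L2_image_def
    using VW L2_power_in[OF inv(1) unitary[OF that]] by (auto intro: W_sat)
  \<comment> \<open>In both cases K contains all nonnegative integers, so the wandering property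
    makes the forward orbit of every vector of V orthogonal.\<close>
  have V_orth: "L2_inner M ((T ^^ m) v) ((T ^^ n) v) = 0" if "v \<in> V" "m \<noteq> n" for v m n
  proof -
    have "v \<in> L2 M" using that VW WL by auto
    then have "(T ^^ n) v \<in> H (int n)" for n
      using that(1) unfolding H_def L2_image_def L2_power_def
      by (auto intro!: Tn_L2 bexI[of _ v] L2_eq_refl)
    then show ?thesis
      using H_orth[of "int m" "int n"] that(2) nonneg_K by (auto simp: L2_ortho_def)
  qed

  obtain g h where g: "g \<in> W" and h: "h \<in> L2_perp M W" and fgh: "L2_eq M f (\<lambda>x. g x + h x)"
    using split f by blast
  have gL: "g \<in> L2 M" and hL: "h \<in> L2 M" using g h WL perpL by auto
  have perp: "L2_inner M h w = 0" "L2_inner M w h = 0" if "w \<in> W" for w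
    using h that by (auto simp: L2_perp_def L2_inner_commute[of M w h])
  have inner_f: "L2_inner M f w = L2_inner M g w + L2_inner M h w" if "w \<in> L2 M" for w
    using L2_inner_cong[OF f L2_add[OF gL hL] that that fgh L2_eq_refl]
      L2_inner_add_left[OF gL hL that] by simp
  obtain u where u: "\<And>k. k \<in> K \<Longrightarrow> u k \<in> H k"
    and lim: "((\<lambda>F. L2_norm M (\<lambda>x. g x - (\<Sum>k\<in>F. u k x))) \<longlongrightarrow> 0) (finite_subsets_at_top K)"
    using g W_sum by (auto simp: L2_direct_sum_def)
  have uL: "u k \<in> L2 M" if "k \<in> K" for k using u[OF that] HL by auto

  \<comment> \<open>\<open>u k\<close> is the projection of f: h is orthogonal to W, which contains
    \<open>H k\<close>, and the other components of g are orthogonal to \<open>H k\<close>.\<close>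
  have "L2_norm M (L2_proj M (H k) f) = L2_norm M (u k)" if k: "k \<in> K" for k
  proof -
    have "L2_inner M (\<lambda>x. f x - u k x) w = 0" if w: "w \<in> H k" for w
    proof -
      have wL: "w \<in> L2 M" and wW: "w \<in> W" using w HL HW[OF k] by auto
      have "L2_inner M g w = L2_inner M (u k) w"
        using H_orth u w k
        by (intro L2_inner_orthogonal_expansion[OF gL uL wL k lim]) (auto simp: L2_ortho_def)
      then show ?thesis
        using inner_f[OF wL] perp(1)[OF wW] by (simp add: L2_inner_diff_left f uL k wL)
    qed
    note proj = L2_proj_unique[OF HL f u[OF k] this]
    then show ?thesis using HL uL[OF k] by (intro L2_norm_cong) auto
  qed
  then have B_sum: "(\<Sum>\<^sub>\<infinity>k\<in>K. ennreal (L2_norm M (u k))) = ennreal B"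
    using B(1) by (simp add: shift_norm_sum_def H_def cong: infsum_cong)
  have B_le: "(\<Sum>k\<in>F. L2_norm M (u k)) \<le> B" if "finite F" "F \<subseteq> K" for F
  proof -
    have "(\<Sum>k\<in>F. ennreal (L2_norm M (u k))) \<le> (\<Sum>\<^sub>\<infinity>k\<in>K. ennreal (L2_norm M (u k)))"
      unfolding nonneg_infsum_complete[OF zero_le] using that by (intro SUP_upper) simp
    then show ?thesis
      using B(2) by (simp add: B_sum L2_norm_nonneg)
  qed
  have orth: "L2_inner M ((T ^^ m) (u k)) ((T ^^ n) (u k)) = 0" if k: "k \<in> K" and "m \<noteq> n" for k m n
  proof -
    obtain v where v: "v \<in> V" "L2_eq M (L2_power M W T k v) (u k)"
      using u[OF k] by (auto simp: H_def L2_image_def)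
    show ?thesis
      using v VW by (intro L2_power_orbit_orthogonal[OF iso WL inv(1) unitary[OF k] _ _ uL[OF k] v(2) that(2)]
          V_orth) auto
  qed
  have "L2_norm M (\<lambda>x. \<Sum>n\<in>{a..<a + l}. (T ^^ n) g x) \<le> sqrt (real l) * B"
    by (rule L2_norm_orbit_sum_le[OF iso gL uL lim orth B_le])
  then have "(L2_norm M (\<lambda>x. \<Sum>n\<in>{a..<a + l}. (T ^^ n) g x))\<^sup>2 \<le> (sqrt (real l) * B)\<^sup>2"
    by (rule power_mono) (rule L2_norm_nonneg)
  then have orbit: "(L2_norm M (\<lambda>x. \<Sum>n\<in>{a..<a + l}. (T ^^ n) g x))\<^sup>2 \<le> real l * B\<^sup>2"
    by (simp add: power_mult_distrib)

  have Th: "L2_eq M ((T ^^ n) h) h" for n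
  proof (induction n)
    case (Suc n)
    have "(T ^^ n) h \<in> L2_perp M W" using inv(2) h by (intro funpow_invariant) auto
    then show ?case using fix_perp Suc.IH by (auto intro: L2_eq_trans)
  qed (simp add: L2_eq_refl)
  have Tf: "L2_eq M ((T ^^ n) f) (\<lambda>x. (T ^^ n) g x + h x)" for n
  proof -
    have 1: "L2_eq M ((T ^^ n) f) ((T ^^ n) (\<lambda>x. g x + h x))"
      by (intro Tn_cong f L2_add gL hL fgh)
    have 2: "L2_eq M ((T ^^ n) (\<lambda>x. g x + h x)) (\<lambda>x. (T ^^ n) g x + (T ^^ n) h x)"
      by (intro L2_isometryD(3)[OF Tn] gL hL)
    have 3: "L2_eq M (\<lambda>x. (T ^^ n) g x + (T ^^ n) h x) (\<lambda>x. (T ^^ n) g x + h x)"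
      by (intro L2_eq_add L2_eq_refl Th)
    show ?thesis by (rule L2_eq_trans[OF 1 L2_eq_trans[OF 2 3]])
  qed
  \<comment> \<open>What remains of f after removing h is g, which lies in W; hence h is the
    projection onto the complement.\<close>
  have "L2_inner M (\<lambda>x. f x - h x) w = 0" if "w \<in> L2_perp M W" for w
  proof -
    have wL: "w \<in> L2 M" using that perpL by auto
    have "L2_inner M g w = 0"
      using that g by (subst L2_inner_commute) (simp add: L2_perp_def)
    then show ?thesis using inner_f[OF wL] by (simp add: L2_inner_diff_left f hL wL)
  qed
  then have "L2_eq M (L2_proj M (L2_perp M W) f) h"
    by (intro L2_proj_unique(2) perpL f h)
  with rep have FP: "F n \<in> L2 M" "L2_eq M (F n) ((T ^^ n) f)" "P \<in> L2 M" "L2_eq M P h" for n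
    by (auto simp: representatives_def intro: L2_eq_trans)
  have "L2_eq M (\<lambda>x. F n x - P x) (\<lambda>x. (T ^^ n) g x)" for n
    using FP(2)[of n] FP(4) Tf[of n] unfolding L2_eq_def by eventually_elim simp
  then have "L2_norm M (\<lambda>x. \<Sum>n\<in>{a..<a + l}. F n x - P x)
      = L2_norm M (\<lambda>x. \<Sum>n\<in>{a..<a + l}. (T ^^ n) g x)"
    by (intro L2_norm_cong L2_eq_sum L2_sum L2_diff FP Tn_L2 gL)
  with orbit show ?thesis by simp
qed

theorem theorem1p3:
  fixes M :: "'a measure"
    and T :: "('a \<Rightarrow> complex) \<Rightarrow> 'a \<Rightarrow> complex"
    and W V :: "('a \<Rightarrow> complex) set"
    and K :: "int set"
    and \<epsilon> :: "real \<Rightarrow> real"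
  assumes "prob_space M"
    and "L2_separable M"
    and "L2_isometry M (L2 M) T"
    and "L2_closed_subspace M W"
    and "\<forall>f\<in>L2 M. \<exists>g\<in>W. \<exists>h\<in>L2_perp M W. L2_eq M f (\<lambda>x. g x + h x)"
    and "\<forall>f\<in>W. T f \<in> W"
    and "\<forall>f\<in>L2_perp M W. T f \<in> L2_perp M W"
    and "unilateral_shift M W T \<and> K = {0..} \<or> bilateral_shift M W T \<and> K = UNIV"
    and "\<forall>f\<in>L2_perp M W. L2_eq M (T f) f"
    and "generating_wandering M W T K V"
    and "\<forall>t\<ge>0. \<epsilon> t > 0"
    and "antimono_on {0..} \<epsilon>"
  shows "(\<exists>c>0. \<forall>f\<in>L2 M. \<forall>F P. representatives M W T f F P \<longrightarrow>
            L2_ennnorm M (maximal_operator \<epsilon> F P)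
              \<le> ennreal c * ennreal_sqrt (log_square_sum \<epsilon>) * shift_norm_sum M W T K V f) \<and>
         (\<forall>f\<in>L2 M. log_square_sum \<epsilon> < \<top> \<and> shift_norm_sum M W T K V f < \<top> \<longrightarrow>
            (\<forall>F P. representatives M W T f F P \<longrightarrow>
               (AE x in M. (\<lambda>N. weighted_deviation \<epsilon> F P N x) \<longlonglongrightarrow> 0)))"
proof (intro conjI exI[of _ "6 / ln 2"] ballI allI impI)
  \<comment> \<open>The constant is the square root of \<open>36 / (ln 2)\<^sup>2\<close> from the
    condensation estimate and depends on neither \<epsilon> nor T.\<close>
  show "0 < 6 / ln (2::real)" by simp
next
  fix f F P assume f: "f \<in> L2 M" and rep: "representatives M W T f F P"
  show "L2_ennnorm M (maximal_operator \<epsilon> F P)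
      \<le> ennreal (6 / ln 2) * ennreal_sqrt (log_square_sum \<epsilon>) * shift_norm_sum M W T K V f"
  proof (cases "shift_norm_sum M W T K V f")
    case (real B)
    then show ?thesis
      using rep maximal_operator_norm_le[of F M P B \<epsilon>]
        shift_orbit_block_le[OF assms(3-10) f rep real(2,1)] assms(11,12)
      by (simp add: representatives_def)
  next
    \<comment> \<open>The right-hand side is infinite, as the factors in front of the infinite sum
      are nonzero.\<close>
    case top
    have "ennreal_sqrt (log_square_sum \<epsilon>) \<noteq> 0"
      using ennreal_sqrt_log_square_sum_pos[OF assms(11)] by simp
    then show ?thesis
      using top by (simp add: ennreal_mult_top)
  qed
next
  fix f F P assume f: "f \<in> L2 M" and rep: "representatives M W T f F P"
    and fin: "log_square_sum \<epsilon> < \<top> \<and> shift_norm_sum M W T K V f < \<top>"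
  then obtain B where B: "shift_norm_sum M W T K V f = ennreal B" "0 \<le> B"
    by (cases "shift_norm_sum M W T K V f") auto
  show "AE x in M. (\<lambda>N. weighted_deviation \<epsilon> F P N x) \<longlonglongrightarrow> 0"
    using rep B(2) fin shift_orbit_block_le[OF assms(3-10) f rep B] assms(11,12)
    by (intro weighted_deviation_tendsto_0[of F M P B]) (auto simp: representatives_def)
qed

end
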